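(* Let $\mu\in\mathcal P_{\nu^t}(nl+|\nu|)$ and let $\widehat{\mathbf V}^\nu=\bigoplus_{i\in\mathbb{Z}}\mathbf W^\mu_i$ be the (unique) $\mu$-grading, with Poincaré polynomial $P_\mu=\sum_i\dim\mathbf W^\mu_i\,t^i$. Then $P_\mu=\mathrm{Res}_{\mu^t}(t)=\sum_{\square\in\mu^t}t^{c(\square)}$. Moreover, the function $\mathcal X_\theta(n\delta+\mathbf d_\nu)^{\mathbb{C}^*}\to\mathbb{Z}[t,t^{-1}]$, $[\mathbf A(\mu)]\mapsto P_\mu$, is injective.
   Context: Assume $l>1$. Fix an $l$-core $\nu$ with $\mathbf d_\nu=(d_0,\dots,d_{l-1})$, where $d_i$ is the number of cells of content $\equiv i\bmod l$ (content $c(i,j)=j-i$). $\widehat{\mathbf V}^\nu=\bigoplus_{i\in\mathbb{Z}/l\mathbb{Z}}\mathbf V_i^\nu$ with $\dim\mathbf V_i^\nu=n+d_i$, and $\mathbf V_\infty=\mathbb{C}v_\infty$. $\theta\in\mathbb{Q}^l$ is such that $\mathcal X_\theta(n\delta+\mathbf d_\nu)$ is smooth. Here $\mathcal X_\theta(\mathbf d)=\mathrm{Spec}\,\mathbb{C}[\mu_{\mathbf d}^{-1}(\theta)]^{\prod GL(\mathbf V_i)}$ for the moment map $[\mathbf X,\mathbf Y]+JI$ on quadruples ($X_i:\mathbf V_i\to\mathbf V_{i+1}$, $Y_i:\mathbf V_i\to\mathbf V_{i-1}$, $I:\mathbf V_0\to\mathbf V_\infty$, $J:\mathbf V_\infty\to\mathbf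 V_0$), with $\mathbb{C}^*$ acting by $(t^{-1}\mathbf X,t\mathbf Y,I,J)$. For $\mu\in\mathcal P_{\nu^t}(nl+|\nu|)$ (partitions with $l$-core $\nu^t$) with Frobenius form $(a_1..a_k\mid b_1..b_k)$, put $r_i=b_i+1$, $m_i=a_i+b_i+1$, $q_i=\sum_{s<i}m_s+r_i$, and $\beta_i=\theta_0+\sum_{s=1}^{r_i-1}\theta_{r_i-s}+\sum_{s=0}^{m_i-r_i-1}\theta_{-m_i+r_i+s}$. $\Lambda(m)$ has ones at $(j,j+1)$. $A(m,r)_{j+1,j}=\sum_{s=1}^j\theta_{r-s}$ ($j<r$) or $-\sum_{s=0}^{m-j-1}\theta_{-m+r+s}$ ($r\le j<m$), zero elsewhere. $A(\mu)$ has diagonal blocks $A(m_i,r_i)$, and its off-diagonal $(i,j)$ blocks are the unique $M$ supported on positions $(s,t)$ with $t-s=r_j-r_i-1$ and satisfying $\Lambda(m_i)M-M\Lambda(m_j)=-\beta_iE(r_i,r_j)$. $\Lambda(\mu)=\mathrm{diag}(\Lambda(m_i))$. $I(\mu)$ has ones in columns $q_i$, and $J(\mu)$ has $\beta_i$ in rows $q_i$. All are taken in the basis $\mathsf{Bas}(j)=v_{\psi(j)}^{\omega(j)}$. Here $(u_j)$ is the sequence $(1..m_1,\dots,1..m_k)$; $\zeta(j)$ is the block index; $\psi(j)=(r_{\zeta(j)}-u_j)\bmod l$; $\omega(j)=\#\{j'\le j:\psi(j')=\psi(j)\}$; and $(v_i^e)$ is a basis of $\mathbf V_i^\nu$. $\mathbf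 A(\mu)=(\Lambda(\mu),A(\mu),I(\mu),J(\mu))$ with $X_i=\Lambda(\mu)|_{\mathbf V_i^\nu}$ and $Y_i=A(\mu)|_{\mathbf V_i^\nu}$. The paper shows that $\mu\mapsto[\mathbf A(\mu)]=G.\mathbf A(\mu)$ is a bijection $\mathcal P_{\nu^t}(nl+|\nu|)\to\mathcal X_\theta(n\delta+\mathbf d_\nu)^{\mathbb{C}^*}$. A $\mu$-grading is a $\mathbb{Z}$-grading $\widehat{\mathbf V}^\nu=\bigoplus_{i\in\mathbb{Z}}\mathbf W_i$ with $A(\mu)\mathbf W_i\subseteq\mathbf W_{i-1}$, $\Lambda(\mu)\mathbf W_i\subseteq\mathbf W_{i+1}$, $J(\mu)\mathbf V_\infty\subseteq\mathbf W_0$, and $I(\mu)\mathbf W_0=\mathbf V_\infty$. The paper shows that a $\mu$-grading exists and is unique. *)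

theory Defs
  imports "HOL-Library.Function_Algebras" "HOL-Computational_Algebra.Formal_Laurent_Series"
begin

text \<open>A partition is represented by its Young diagram: a finite down-closed set of cells
  (i,j) (row i, column j, both 0-based). Content c(i,j) = j - i.\<close>

definition young :: "(nat \<times> nat) set \<Rightarrow> bool" where
  "young Y \<longleftrightarrow> finite Y \<and>
     (\<forall>i j i' j'. (i, j) \<in> Y \<longrightarrow> i' \<le> i \<longrightarrow> j' \<le> j \<longrightarrow> (i', j') \<in> Y)"

definition transp_diag :: "(nat \<times> nat) set \<Rightarrow> (nat \<times> nat) set" where
  "transp_diag Y = (\<lambda>(i, j). (j, i)) ` Y"

definition content :: "nat \<times> nat \<Rightarrow> int" where
  "content c = int (snd c) - int (fst c)"

definition cell_adj :: "nat \<times> nat \<Rightarrow> nat \<times> nat \<Rightarrow> bool" where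
  "cell_adj a b \<longleftrightarrow> (fst a = fst b \<and> (snd b = snd a + 1 \<or> snd a = snd b + 1)) \<or>
                      (snd a = snd b \<and> (fst b = fst a + 1 \<or> fst a = fst b + 1))"

definition cells_connected :: "(nat \<times> nat) set \<Rightarrow> bool" where
  "cells_connected S \<longleftrightarrow>
     (\<forall>a\<in>S. \<forall>b\<in>S. (a, b) \<in> {(x, y). x \<in> S \<and> y \<in> S \<and> cell_adj x y}\<^sup>*)"

definition rim_hook_removal :: "nat \<Rightarrow> (nat \<times> nat) set \<Rightarrow> (nat \<times> nat) set \<Rightarrow> bool" where
  "rim_hook_removal l Y Z \<longleftrightarrow> young Y \<and> young Z \<and> Z \<subseteq> Y \<and> card (Y - Z) = l \<and>
     cells_connected (Y - Z) \<and>
     \<not> (\<exists>i j. {(i, j), (i + 1, j), (i, j + 1), (i + 1, j + 1)} \<subseteq> Y - Z)"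

definition is_core :: "nat \<Rightarrow> (nat \<times> nat) set \<Rightarrow> bool" where
  "is_core l Y \<longleftrightarrow> young Y \<and> \<not> (\<exists>Z. rim_hook_removal l Y Z)"

definition has_core :: "nat \<Rightarrow> (nat \<times> nat) set \<Rightarrow> (nat \<times> nat) set \<Rightarrow> bool" where
  "has_core l Y C \<longleftrightarrow> young Y \<and> (rim_hook_removal l)\<^sup>*\<^sup>* Y C \<and> is_core l C"

definition partitions_with_core :: "nat \<Rightarrow> (nat \<times> nat) set \<Rightarrow> nat \<Rightarrow> (nat \<times> nat) set set" where
  "partitions_with_core l C N = {Y. young Y \<and> card Y = N \<and> has_core l Y C}"

definition dvec :: "nat \<Rightarrow> (nat \<times> nat) set \<Rightarrow> nat \<Rightarrow> nat" where
  "dvec l Y i = card {c \<in> Y. content c mod int l = int i}"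

definition Res :: "(nat \<times> nat) set \<Rightarrow> int fls" where
  "Res Y = (\<Sum>c\<in>Y. fls_X_intpow (content c))"

text \<open>Positive roots of affine type A_(l-1) (l > 1), written as cyclic intervals:
  the root starting at i of length L has k-th coordinate #{s < L. (i+s) mod l = k}.\<close>
definition cyc_root :: "nat \<Rightarrow> nat \<Rightarrow> nat \<Rightarrow> nat \<Rightarrow> nat" where
  "cyc_root l i L k = card {s. s < L \<and> (i + s) mod l = k}"

definition theta_generic :: "nat \<Rightarrow> (nat \<Rightarrow> rat) \<Rightarrow> (nat \<Rightarrow> nat) \<Rightarrow> bool" where
  "theta_generic l \<theta> v \<longleftrightarrow>
     (\<forall>i<l. \<forall>L\<ge>1. (\<forall>k<l. cyc_root l i L k \<le> v k) \<longrightarrow>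
        (\<Sum>k<l. \<theta> k * of_nat (cyc_root l i L k)) \<noteq> 0)"

text \<open>Indices in Z/lZ: theta_k for integer k means theta_(k mod l).\<close>
definition th :: "nat \<Rightarrow> (nat \<Rightarrow> rat) \<Rightarrow> int \<Rightarrow> complex" where
  "th l \<theta> k = of_rat (\<theta> (nat (k mod int l)))"

text \<open>Frobenius form (a_1..a_k | b_1..b_k); blocks are indexed b = 0..k-1.\<close>
definition frob_k :: "(nat \<times> nat) set \<Rightarrow> nat" where
  "frob_k Y = card {i. (i, i) \<in> Y}"

definition frob_a :: "(nat \<times> nat) set \<Rightarrow> nat \<Rightarrow> nat" where
  "frob_a Y b = card {j. (b, j) \<in> Y} - b - 1"

definition frob_b :: "(nat \<times> nat) set \<Rightarrow> nat \<Rightarrow> nat" where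
  "frob_b Y b = card {i. (i, b) \<in> Y} - b - 1"

definition rr :: "(nat \<times> nat) set \<Rightarrow> nat \<Rightarrow> nat" where
  "rr Y b = frob_b Y b + 1"

definition mm :: "(nat \<times> nat) set \<Rightarrow> nat \<Rightarrow> nat" where
  "mm Y b = frob_a Y b + frob_b Y b + 1"

definition offs :: "(nat \<times> nat) set \<Rightarrow> nat \<Rightarrow> nat" where
  "offs Y b = (\<Sum>s<b. mm Y s)"

text \<open>Global positions p = 0..N-1 (0-based); block zeta(p) and local 1-based index u_p.\<close>
definition blk :: "(nat \<times> nat) set \<Rightarrow> nat \<Rightarrow> nat" where
  "blk Y p = (THE b. b < frob_k Y \<and> offs Y b \<le> p \<and> p < offs Y b + mm Y b)"

definition loc :: "(nat \<times> nat) set \<Rightarrow> nat \<Rightarrow> nat" where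
  "loc Y p = p - offs Y (blk Y p) + 1"

definition beta :: "nat \<Rightarrow> (nat \<Rightarrow> rat) \<Rightarrow> (nat \<times> nat) set \<Rightarrow> nat \<Rightarrow> complex" where
  "beta l \<theta> Y b = th l \<theta> 0
      + (\<Sum>s\<in>{1..<rr Y b}. th l \<theta> (int (rr Y b) - int s))
      + (\<Sum>s\<in>{0..<mm Y b - rr Y b}. th l \<theta> (- int (mm Y b) + int (rr Y b) + int s))"

text \<open>A(m,r), 1-based entries: A_(j+1,j) for 1 \<le> j < m.\<close>
definition Aloc :: "nat \<Rightarrow> (nat \<Rightarrow> rat) \<Rightarrow> nat \<Rightarrow> nat \<Rightarrow> nat \<Rightarrow> nat \<Rightarrow> complex" where
  "Aloc l \<theta> m r s t =
     (if s = t + 1 \<and> 1 \<le> t \<and> t < m then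
        (if t < r then (\<Sum>x\<in>{1..t}. th l \<theta> (int r - int x))
         else - (\<Sum>x\<in>{0..<m - t}. th l \<theta> (- int m + int r + int x)))
      else 0)"

text \<open>Off-diagonal block (b,c): the unique m_b x m_c matrix M (1-based entries, zero outside
  the range) supported on t - s = r_c - r_b - 1 with Lambda(m_b) M - M Lambda(m_c) = -beta_b E(r_b,r_c).\<close>
definition offblk :: "nat \<Rightarrow> (nat \<Rightarrow> rat) \<Rightarrow> (nat \<times> nat) set \<Rightarrow> nat \<Rightarrow> nat \<Rightarrow> nat \<Rightarrow> nat \<Rightarrow> complex" where
  "offblk l \<theta> Y b c = (THE M :: nat \<Rightarrow> nat \<Rightarrow> complex.
     (\<forall>s t. M s t \<noteq> 0 \<longrightarrow> 1 \<le> s \<and> s \<le> mm Y b \<and> 1 \<le> t \<and> t \<le> mm Y c \<and>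
                           int t - int s = int (rr Y c) - int (rr Y b) - 1) \<and>
     (\<forall>s t. 1 \<le> s \<longrightarrow> s \<le> mm Y b \<longrightarrow> 1 \<le> t \<longrightarrow> t \<le> mm Y c \<longrightarrow>
        (if s < mm Y b then M (s + 1) t else 0) - (if 1 < t then M s (t - 1) else 0)
          = (if s = rr Y b \<and> t = rr Y c then - beta l \<theta> Y b else 0)))"

text \<open>Global N x N matrices, 0-based positions.\<close>
definition Amat :: "nat \<Rightarrow> (nat \<Rightarrow> rat) \<Rightarrow> (nat \<times> nat) set \<Rightarrow> nat \<Rightarrow> nat \<Rightarrow> complex" where
  "Amat l \<theta> Y p q =
     (if blk Y p = blk Y q then Aloc l \<theta> (mm Y (blk Y p)) (rr Y (blk Y p)) (loc Y p) (loc Y q)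
      else offblk l \<theta> Y (blk Y p) (blk Y q) (loc Y p) (loc Y q))"

definition Lmat :: "(nat \<times> nat) set \<Rightarrow> nat \<Rightarrow> nat \<Rightarrow> complex" where
  "Lmat Y p q = (if blk Y p = blk Y q \<and> loc Y q = loc Y p + 1 then 1 else 0)"

text \<open>I(mu): row vector with ones in columns q_b; J(mu): column vector with beta_b in rows q_b
  (q_b 1-based = offs b + r_b, i.e. 0-based position offs b + r_b - 1).\<close>
definition Ivec :: "(nat \<times> nat) set \<Rightarrow> nat \<Rightarrow> complex" where
  "Ivec Y p = (if \<exists>b < frob_k Y. p = offs Y b + rr Y b - 1 then 1 else 0)"

definition Jvec :: "nat \<Rightarrow> (nat \<Rightarrow> rat) \<Rightarrow> (nat \<times> nat) set \<Rightarrow> nat \<Rightarrow> complex" where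
  "Jvec l \<theta> Y p = (if \<exists>b < frob_k Y. p = offs Y b + rr Y b - 1
                     then beta l \<theta> Y (THE b. b < frob_k Y \<and> p = offs Y b + rr Y b - 1) else 0)"

definition cscale :: "complex \<Rightarrow> (nat \<Rightarrow> complex) \<Rightarrow> (nat \<Rightarrow> complex)" where
  "cscale c v = (\<lambda>p. c * v p)"

definition Vsp :: "nat \<Rightarrow> (nat \<Rightarrow> complex) set" where
  "Vsp N = {v. \<forall>p\<ge>N. v p = 0}"

definition mat_app :: "nat \<Rightarrow> (nat \<Rightarrow> nat \<Rightarrow> complex) \<Rightarrow> (nat \<Rightarrow> complex) \<Rightarrow> (nat \<Rightarrow> complex)" where
  "mat_app N M v = (\<lambda>p. if p < N then (\<Sum>q<N. M p q * v q) else 0)"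

definition row_app :: "nat \<Rightarrow> (nat \<Rightarrow> complex) \<Rightarrow> (nat \<Rightarrow> complex) \<Rightarrow> complex" where
  "row_app N r v = (\<Sum>q<N. r q * v q)"

definition is_mu_grading :: "nat \<Rightarrow> (nat \<Rightarrow> rat) \<Rightarrow> (nat \<times> nat) set \<Rightarrow> (int \<Rightarrow> (nat \<Rightarrow> complex) set) \<Rightarrow> bool" where
  "is_mu_grading l \<theta> Y W \<longleftrightarrow>
     (let N = card Y in
      (\<forall>i. module.subspace cscale (W i) \<and> W i \<subseteq> Vsp N) \<and>
      (\<forall>v\<in>Vsp N. \<exists>!w. (\<forall>i. w i \<in> W i) \<and> finite {i. w i \<noteq> 0} \<and> v = (\<Sum>i\<in>{i. w i \<noteq> 0}. w i)) \<and>
      (\<forall>i. \<forall>w\<in>W i. mat_app N (Amat l \<theta> Y) w \<in> W (i - 1)) \<and>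
      (\<forall>i. \<forall>w\<in>W i. mat_app N (Lmat Y) w \<in> W (i + 1)) \<and>
      range (\<lambda>c. cscale c (Jvec l \<theta> Y)) \<subseteq> W 0 \<and>
      (row_app N (Ivec Y)) ` W 0 = UNIV)"

definition cdim :: "(nat \<Rightarrow> complex) set \<Rightarrow> nat" where
  "cdim S = vector_space.dim cscale S"

definition poincare :: "(int \<Rightarrow> (nat \<Rightarrow> complex) set) \<Rightarrow> int fls" where
  "poincare W = (\<Sum>i\<in>{i. W i \<noteq> {0}}. of_nat (cdim (W i)) * fls_X_intpow i)"

end

theory Submission
  imports Defs
begin

text \<open>
  Order the coordinates of \<open>\<^bold>V\<close> along the Frobenius hooks of \<open>\<mu>\<close>: position \<open>u\<close> of block
  \<open>b\<close> sits on the cell of the \<open>b\<close>-th hook of content \<open>u - r\<^sub>b\<close> and gets degree \<open>r\<^sub>b - u\<close>.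
  In these coordinates \<open>\<Lambda>\<^sup>d J\<close> is a \<open>\<beta>\<close>-weighted sum of coordinate vectors of degree \<open>d\<close>;
  removing the hooks one at a time isolates the coordinate vectors on the legs, and applying
  \<open>A\<close> to them walks down the arms. Each new coordinate vector appears with a coefficient that
  is a sum of \<open>\<theta>\<close> over the residues of a segment of a hook of \<open>\<mu>\<close>; since \<open>\<mu>\<close> has the
  residue counts of \<open>\<nu>\<^sup>t\<close> plus \<open>n\<close> rim hooks, genericity of \<open>\<theta>\<close> makes it nonzero. Hence every
  coordinate vector is homogeneous, uniqueness of the decomposition forces \<open>\<^bold>W\<^sub>i\<close> to be
  spanned by the coordinate vectors of degree \<open>i\<close>, and \<open>P\<^sub>\<mu>\<close> is the sum of \<open>t\<close> to the
  negated contents of the cells of \<open>\<mu>\<close>, which is the residue of \<open>\<mu>\<^sup>t\<close>. Injectivity holds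
  because a Young diagram is determined by the lengths of its diagonals, which its residue
  records.
\<close>

section \<open>Young diagrams and their Frobenius hooks\<close>

lemma down_closed_nat_set_eq_lessThan:
  fixes S :: "nat set"
  assumes "finite S" "\<And>x y. x \<in> S \<Longrightarrow> y \<le> x \<Longrightarrow> y \<in> S"
  shows "S = {..<card S}"
proof (cases "S = {}")
  case False
  define M where "M = Max S"
  have "M \<in> S" using False assms(1) M_def by simp
  then have "S = {..M}" using assms M_def by (auto intro: Max_ge)
  then show ?thesis by (simp add: lessThan_Suc_atMost)
qed simp

lemma young_down_closed: "young Y \<Longrightarrow> (i, j) \<in> Y \<Longrightarrow> i' \<le> i \<Longrightarrow> j' \<le> j \<Longrightarrow> (i', j') \<in> Y"
  unfolding young_def by blast

lemma inj_on_swap: "inj_on (\<lambda>(i, j). (j, i)) (A :: (nat \<times> nat) set)"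
  by (auto simp: inj_on_def)

lemma content_swap: "content ((\<lambda>(i, j). (j, i)) c) = - content c"
  unfolding content_def by (cases c) auto

lemma mem_transp_diag: "(i, j) \<in> transp_diag Y \<longleftrightarrow> (j, i) \<in> Y"
  unfolding transp_diag_def by force

lemma transp_diag_transp_diag: "transp_diag (transp_diag Y) = Y"
  unfolding transp_diag_def by (force simp: image_image)

lemma young_transp_diag: "young Y \<Longrightarrow> young (transp_diag Y)"
  unfolding young_def mem_transp_diag[abs_def] transp_diag_def by auto

lemma card_transp_diag: "card (transp_diag Y) = card Y"
  unfolding transp_diag_def by (rule card_image[OF inj_on_swap])

lemma sum_transp_diag: "(\<Sum>c\<in>transp_diag Y. f c) = (\<Sum>c\<in>Y. f ((\<lambda>(i, j). (j, i)) c))"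
  unfolding transp_diag_def by (simp add: sum.reindex[OF inj_on_swap] comp_def)

locale young_diagram =
  fixes Y :: "(nat \<times> nat) set"
  assumes young: "young Y"
begin

lemma finite_cells: "finite Y"
  using young unfolding young_def by blast

lemmas down_closed = young_down_closed[OF young]

definition row_len :: "nat \<Rightarrow> nat" where "row_len i = card {j. (i, j) \<in> Y}"
definition col_len :: "nat \<Rightarrow> nat" where "col_len j = card {i. (i, j) \<in> Y}"

lemma finite_row: "finite {j. (i, j) \<in> Y}"
proof -
  have "{j. (i, j) \<in> Y} \<subseteq> snd ` Y" by force
  then show ?thesis using finite_cells finite_subset by blast
qed

lemma finite_col: "finite {i. (i, j) \<in> Y}"
proof -
  have "{i. (i, j) \<in> Y} \<subseteq> fst ` Y" by force
  then show ?thesis using finite_cells finite_subset by blast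
qed

lemma mem_iff_less_row_len: "(i, j) \<in> Y \<longleftrightarrow> j < row_len i"
proof -
  have "{j. (i, j) \<in> Y} = {..<row_len i}"
    unfolding row_len_def by (rule down_closed_nat_set_eq_lessThan[OF finite_row]) (auto intro: down_closed)
  then show ?thesis by blast
qed

lemma mem_iff_less_col_len: "(i, j) \<in> Y \<longleftrightarrow> i < col_len j"
proof -
  have "{i. (i, j) \<in> Y} = {..<col_len j}"
    unfolding col_len_def by (rule down_closed_nat_set_eq_lessThan[OF finite_col]) (auto intro: down_closed)
  then show ?thesis by blast
qed

abbreviation "K \<equiv> frob_k Y"

lemma diag_mem_iff: "(b, b) \<in> Y \<longleftrightarrow> b < K"
proof -
  have "finite {i. (i, i) \<in> Y}"
    using finite_col[of 0] by (rule finite_subset[rotated]) (auto intro: down_closed)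
  then have "{i. (i, i) \<in> Y} = {..<K}"
    unfolding frob_k_def by (rule down_closed_nat_set_eq_lessThan) (auto intro: down_closed)
  then show ?thesis by blast
qed

lemma row_len_antimono: "b \<le> c \<Longrightarrow> row_len c \<le> row_len b"
  unfolding row_len_def by (rule card_mono[OF finite_row]) (auto intro: down_closed)

lemma col_len_antimono: "b \<le> c \<Longrightarrow> col_len c \<le> col_len b"
  unfolding col_len_def by (rule card_mono[OF finite_col]) (auto intro: down_closed)

abbreviation "r \<equiv> rr Y"
abbreviation "m \<equiv> mm Y"

lemma rr_pos: "1 \<le> r b" unfolding rr_def by simp
lemma mm_pos: "1 \<le> m b" unfolding mm_def by simp
lemma rr_le_mm: "r b \<le> m b" unfolding rr_def mm_def by simp

lemma rr_eq_col_len: "b < K \<Longrightarrow> r b = col_len b - b"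
  using diag_mem_iff mem_iff_less_col_len[of b b] unfolding rr_def frob_b_def col_len_def by simp

lemma arm_eq_row_len: "b < K \<Longrightarrow> m b - r b = row_len b - b - 1"
  using diag_mem_iff mem_iff_less_row_len[of b b] unfolding rr_def mm_def frob_a_def row_len_def by simp

lemma rr_strict_antimono: "b < c \<Longrightarrow> c < K \<Longrightarrow> r c < r b"
  using col_len_antimono[of b c] diag_mem_iff mem_iff_less_col_len[of c c] rr_eq_col_len[of b] rr_eq_col_len[of c]
  by simp

lemma arm_strict_antimono: "b < c \<Longrightarrow> c < K \<Longrightarrow> m c - r c < m b - r b"
  using row_len_antimono[of b c] diag_mem_iff mem_iff_less_row_len[of c c] arm_eq_row_len[of b] arm_eq_row_len[of c]
  by simp

end

context young_diagram
begin

lemma offs_Suc: "offs Y (Suc b) = offs Y b + m b"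
  unfolding offs_def by simp

lemma offs_add_mm_le: "b < c \<Longrightarrow> offs Y b + m b \<le> offs Y c"
proof (induction c)
  case (Suc c)
  then show ?case using offs_Suc[of c] by (cases "b = c") auto
qed simp

lemma in_some_block: "p < offs Y L \<Longrightarrow> \<exists>b<L. offs Y b \<le> p \<and> p < offs Y b + m b"
proof (induction L)
  case (Suc L)
  show ?case
  proof (cases "p < offs Y L")
    case True then show ?thesis using Suc.IH by (metis less_SucI)
  next
    case False then show ?thesis using Suc.prems offs_Suc[of L] by (intro exI[of _ L]) simp
  qed
qed (simp add: offs_def)

lemma blk_eqI:
  assumes "b < K" "offs Y b \<le> p" "p < offs Y b + m b"
  shows "blk Y p = b"
  unfolding blk_def
proof (rule the_equality)
  fix c assume "c < K \<and> offs Y c \<le> p \<and> p < offs Y c + m c"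
  then show "c = b"
    using assms offs_add_mm_le[of b c] offs_add_mm_le[of c b] by (cases b c rule: linorder_cases) auto
qed (use assms in simp)

definition block_index :: "(nat \<times> nat) set" where
  "block_index = {(b, u). b < K \<and> 1 \<le> u \<and> u \<le> m b}"

lemma block_indexI: "b < K \<Longrightarrow> 1 \<le> u \<Longrightarrow> u \<le> m b \<Longrightarrow> (b, u) \<in> block_index"
  unfolding block_index_def by simp

lemma block_indexD: "(b, u) \<in> block_index \<Longrightarrow> b < K \<and> 1 \<le> u \<and> u \<le> m b"
  unfolding block_index_def by simp

definition pos :: "nat \<Rightarrow> nat \<Rightarrow> nat" where
  "pos b u = offs Y b + u - 1"

lemma blk_pos: "(b, u) \<in> block_index \<Longrightarrow> blk Y (pos b u) = b"
  unfolding pos_def by (rule blk_eqI) (auto dest: block_indexD)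

lemma loc_pos: "(b, u) \<in> block_index \<Longrightarrow> loc Y (pos b u) = u"
  unfolding loc_def using blk_pos[of b u] block_indexD[of b u] unfolding pos_def by simp

lemma pos_inj:
  "(b, u) \<in> block_index \<Longrightarrow> (c, w) \<in> block_index \<Longrightarrow> pos b u = pos c w \<Longrightarrow> b = c \<and> u = w"
  using blk_pos loc_pos by metis

lemma pos_less_offs: "(b, u) \<in> block_index \<Longrightarrow> pos b u < offs Y K"
  unfolding pos_def using offs_add_mm_le[of b K] by (auto dest: block_indexD)

lemma less_offs_cases:
  assumes "p < offs Y K"
  obtains b u where "(b, u) \<in> block_index" "p = pos b u"
proof -
  obtain b where b: "b < K" "offs Y b \<le> p" "p < offs Y b + m b"
    using in_some_block[OF assms] by blast
  then have "(b, p - offs Y b + 1) \<in> block_index" "p = pos b (p - offs Y b + 1)"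
    unfolding block_index_def pos_def by auto
  then show ?thesis using that by blast
qed

lemma bij_betw_pos: "bij_betw (\<lambda>(b, u). pos b u) block_index {..<offs Y K}"
proof (rule bij_betw_imageI)
  show "inj_on (\<lambda>(b, u). pos b u) block_index" using pos_inj by (auto simp: inj_on_def)
  show "(\<lambda>(b, u). pos b u) ` block_index = {..<offs Y K}"
    using pos_less_offs by (auto elim!: less_offs_cases)
qed

text \<open>Local index \<open>u\<close> of block \<open>b\<close> runs up the leg of the \<open>b\<close>-th hook to the diagonal
  cell (\<open>u = r b\<close>) and then along its arm.\<close>
definition hook_cell :: "nat \<Rightarrow> nat \<Rightarrow> nat \<times> nat" where
  "hook_cell b u = (if u \<le> r b then (b + r b - u, b) else (b, b + u - r b))"

lemma content_hook_cell: "content (hook_cell b u) = int u - int (r b)"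
  unfolding hook_cell_def content_def by auto

lemma hook_cell_mem: "(b, u) \<in> block_index \<Longrightarrow> hook_cell b u \<in> Y"
  using rr_eq_col_len[of b] arm_eq_row_len[of b] diag_mem_iff[of b] rr_le_mm[of b]
    mem_iff_less_col_len[of _ b] mem_iff_less_row_len[of b]
  unfolding hook_cell_def by (auto dest!: block_indexD)

lemma inj_on_hook_cell: "inj_on (\<lambda>(b, u). hook_cell b u) block_index"
proof (rule inj_onI, clarify)
  fix b u c w assume eq: "hook_cell b u = hook_cell c w"
  have "b = c"
    using arg_cong[OF eq, of "\<lambda>x. min (fst x) (snd x)"] unfolding hook_cell_def by (auto split: if_splits)
  moreover have "int u - int (r b) = int w - int (r c)"
    using arg_cong[OF eq, of content] by (simp add: content_hook_cell)
  ultimately show "b = c \<and> u = w" by simp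
qed

lemma hook_cell_surj: "Y \<subseteq> (\<lambda>(b, u). hook_cell b u) ` block_index"
proof (clarify)
  fix i j assume ij: "(i, j) \<in> Y"
  show "(i, j) \<in> (\<lambda>(b, u). hook_cell b u) ` block_index"
  proof (cases "j \<le> i")
    case True
    have "j < K" using down_closed[OF ij, of j j] True diag_mem_iff by simp
    moreover have "i < col_len j" using ij mem_iff_less_col_len by blast
    ultimately have "(j, r j - (i - j)) \<in> block_index" "hook_cell j (r j - (i - j)) = (i, j)"
      using True rr_eq_col_len[of j] rr_le_mm[of j] unfolding block_index_def hook_cell_def by auto
    then show ?thesis by force
  next
    case False
    have "i < K" using down_closed[OF ij, of i i] False diag_mem_iff by simp
    moreover have "j < row_len i" using ij mem_iff_less_row_len by blast
    ultimately have "(i, r i + (j - i)) \<in> block_index" "hook_cell i (r i + (j - i)) = (i, j)"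
      using False arm_eq_row_len[of i] rr_le_mm[of i] rr_pos[of i]
      unfolding block_index_def hook_cell_def by auto
    then show ?thesis by force
  qed
qed

lemma bij_betw_hook_cell: "bij_betw (\<lambda>(b, u). hook_cell b u) block_index Y"
  unfolding bij_betw_def using inj_on_hook_cell hook_cell_surj hook_cell_mem by fastforce

lemma card_eq_offs: "card Y = offs Y K"
  using bij_betw_same_card[OF bij_betw_hook_cell] bij_betw_same_card[OF bij_betw_pos] by simp

end

section \<open>Residues of rim hooks\<close>

definition residue_count :: "nat \<Rightarrow> (nat \<times> nat) set \<Rightarrow> nat \<Rightarrow> nat" where
  "residue_count l Y k = card {c \<in> Y. (- content c) mod int l = int k}"

lemma inj_on_content_rim_hook:
  assumes R: "rim_hook_removal l Y Z"
  shows "inj_on content (Y - Z)"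
proof -
  have yY: "young Y" and yZ: "young Z"
    and no_square: "\<not> {(i, j), (i + 1, j), (i, j + 1), (i + 1, j + 1)} \<subseteq> Y - Z" for i j
    using R unfolding rim_hook_removal_def by auto
  have no_nested: False
    if ij: "(i1, j1) \<in> Y - Z" "(i2, j2) \<in> Y - Z" "i1 < i2" "j1 < j2" for i1 j1 i2 j2
  proof -
    have "(i, j) \<in> Y - Z" if "i1 \<le> i" "i \<le> i2" "j1 \<le> j" "j \<le> j2" for i j
      using young_down_closed[OF yY ij(2)[THEN DiffD1]] young_down_closed[OF yZ, of i j i1 j1] ij(1) that
      by auto
    then have "{(i1, j1), (i1 + 1, j1), (i1, j1 + 1), (i1 + 1, j1 + 1)} \<subseteq> Y - Z"
      using ij(3,4) by auto
    then show False using no_square by blast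
  qed
  show ?thesis
  proof (rule inj_onI)
    fix a b assume "a \<in> Y - Z" "b \<in> Y - Z" "content a = content b"
    moreover obtain i1 j1 i2 j2 where "a = (i1, j1)" "b = (i2, j2)" by force
    ultimately show "a = b"
      using no_nested[of i1 j1 i2 j2] no_nested[of i2 j2 i1 j1] unfolding content_def
      by (cases i1 i2 rule: linorder_cases) auto
  qed
qed

lemma content_cell_adj: "cell_adj a b \<Longrightarrow> content b = content a + 1 \<or> content b = content a - 1"
  unfolding cell_adj_def content_def by auto

lemma content_path_intermediate:
  assumes "(a, b) \<in> {(x, y). x \<in> S \<and> y \<in> S \<and> cell_adj x y}\<^sup>*" "a \<in> S"
    and "min (content a) (content b) \<le> z" "z \<le> max (content a) (content b)"
  shows "z \<in> content ` S"
  using assms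
proof (induction arbitrary: z rule: rtrancl_induct)
  case (step y b)
  then show ?case
    using content_cell_adj[of y b] by (cases "z = content b") (auto simp: min_def max_def split: if_splits)
qed auto

lemma content_rim_hook_interval:
  assumes R: "rim_hook_removal l Y Z" and l: "l > 0"
  obtains x where "content ` (Y - Z) = {x..<x + int l}"
proof -
  let ?C = "content ` (Y - Z)"
  have "finite (Y - Z)" using R unfolding rim_hook_removal_def young_def by auto
  then have fin: "finite ?C" by simp
  have card: "card ?C = l"
    using card_image[OF inj_on_content_rim_hook[OF R]] R unfolding rim_hook_removal_def by simp
  then have ne: "?C \<noteq> {}" using l by (metis card.empty less_irrefl)
  have "{Min ?C..Max ?C} \<subseteq> ?C"
  proof
    fix z assume z: "z \<in> {Min ?C..Max ?C}"
    obtain a b where "a \<in> Y - Z" "b \<in> Y - Z" "content a = Min ?C" "content b = Max ?C"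
      using Min_in[OF fin ne] Max_in[OF fin ne] by auto
    then show "z \<in> ?C"
      using R z content_path_intermediate[of a b "Y - Z" z]
      unfolding rim_hook_removal_def cells_connected_def by auto
  qed
  then have eq: "?C = {Min ?C..Max ?C}" using fin by auto
  have "nat (Max ?C - Min ?C + 1) = l" using card eq by (metis card_atLeastAtMost_int)
  moreover have "Min ?C \<le> Max ?C" using fin ne by simp
  ultimately have "Max ?C = Min ?C + int l - 1" by (simp add: nat_eq_iff)
  then show ?thesis using eq that[of "Min ?C"] by fastforce
qed

lemma card_interval_residue:
  fixes x :: int and l k :: nat
  assumes "l > 0" "k < l"
  shows "card {y \<in> {x..<x + int l}. (- y) mod int l = int k} = 1"
proof -
  define y0 where "y0 = x + ((- x - int k) mod int l)"
  have y0: "y0 \<in> {x..<x + int l}" "(- y0) mod int l = int k"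
  proof -
    show "y0 \<in> {x..<x + int l}" using assms unfolding y0_def by simp
    have "- y0 = int k + int l * ((- x - int k) div int l)"
      unfolding y0_def using div_mult_mod_eq[of "- x - int k" "int l"] by (simp add: algebra_simps)
    then show "(- y0) mod int l = int k" using assms by simp
  qed
  have "y = y0" if y: "y \<in> {x..<x + int l}" "(- y) mod int l = int k" for y
  proof -
    have "int l dvd (y0 - x) - (y - x)"
      using y(2) y0(2) mod_eq_dvd_iff[of "- y" "int l" "- y0"] by simp
    then have "(y0 - x) mod int l = (y - x) mod int l" by (simp only: mod_eq_dvd_iff)
    then show ?thesis using y(1) y0(1) by (simp add: mod_pos_pos_trivial)
  qed
  then have "{y \<in> {x..<x + int l}. (- y) mod int l = int k} = {y0}" using y0 by blast
  then show ?thesis by simp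
qed

lemma card_rim_hook_residue:
  assumes R: "rim_hook_removal l Y Z" and l: "l > 0" and k: "k < l"
  shows "card {c \<in> Y - Z. (- content c) mod int l = int k} = 1"
proof -
  obtain x where x: "content ` (Y - Z) = {x..<x + int l}"
    using content_rim_hook_interval[OF R l] by blast
  let ?A = "{c \<in> Y - Z. (- content c) mod int l = int k}"
  have img: "content ` ?A = {y \<in> {x..<x + int l}. (- y) mod int l = int k}"
    unfolding x[symmetric] by auto
  have "inj_on content ?A"
    using inj_on_content_rim_hook[OF R] by (rule inj_on_subset) auto
  then have "card ?A = card (content ` ?A)" by (simp add: card_image)
  then show ?thesis unfolding img card_interval_residue[OF l k] .
qed

lemma residue_count_rim_hook_chain:
  assumes "(rim_hook_removal l)\<^sup>*\<^sup>* Y C" "l > 0"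
  obtains s where "card Y = card C + s * l" "\<And>k. k < l \<Longrightarrow> residue_count l Y k = residue_count l C k + s"
proof -
  have "\<exists>s. card Y = card C + s * l \<and> (\<forall>k<l. residue_count l Y k = residue_count l C k + s)"
    using assms(1)
  proof (induction rule: rtranclp_induct)
    case base
    show ?case by (intro exI[of _ 0]) simp
  next
    case (step Z C')
    obtain s where s: "card Y = card Z + s * l" "\<forall>k<l. residue_count l Y k = residue_count l Z k + s"
      using step.IH by blast
    have sub: "C' \<subseteq> Z" and finZ: "finite Z" and card_hook: "card (Z - C') = l"
      using step.hyps(2) unfolding rim_hook_removal_def young_def by auto
    have "card Z = card C' + l"
      using card_hook card_Diff_subset[OF finite_subset[OF sub finZ] sub] card_mono[OF finZ sub] by simp
    moreover have "residue_count l Z k = residue_count l C' k + 1" if "k < l" for k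
    proof -
      let ?P = "\<lambda>c. (- content c) mod int l = int k"
      have "{c \<in> Z. ?P c} = {c \<in> C'. ?P c} \<union> {c \<in> Z - C'. ?P c}" using sub by blast
      then have "card {c \<in> Z. ?P c} = card {c \<in> C'. ?P c} + card {c \<in> Z - C'. ?P c}"
        using finite_subset[OF sub finZ] finZ by (simp add: card_Un_disjoint disjoint_iff)
      then show ?thesis
        unfolding residue_count_def using card_rim_hook_residue[OF step.hyps(2) assms(2) that] by simp
    qed
    ultimately show ?case using s by (intro exI[of _ "Suc s"]) auto
  qed
  then show ?thesis using that by blast
qed

lemma residue_count_transp_diag: "residue_count l (transp_diag Y) k = dvec l Y k"
proof -
  have "{c \<in> transp_diag Y. (- content c) mod int l = int k} =
        (\<lambda>(i, j). (j, i)) ` {c \<in> Y. content c mod int l = int k}"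
  proof -
    have "{c \<in> h ` Y. P c} = h ` {c \<in> Y. P (h c)}" for h :: "nat \<times> nat \<Rightarrow> nat \<times> nat" and P
      by blast
    then show ?thesis unfolding transp_diag_def by (simp add: content_swap)
  qed
  then show ?thesis
    unfolding residue_count_def dvec_def using card_image[OF inj_on_swap] by simp
qed

lemma residue_count_partitions_with_core:
  assumes l: "l > 0" and mu: "\<mu> \<in> partitions_with_core l (transp_diag \<nu>) (n * l + card \<nu>)"
    and k: "k < l"
  shows "residue_count l \<mu> k = n + dvec l \<nu> k"
proof -
  have "(rim_hook_removal l)\<^sup>*\<^sup>* \<mu> (transp_diag \<nu>)" and card_mu: "card \<mu> = n * l + card \<nu>"
    using mu unfolding partitions_with_core_def has_core_def by auto
  then obtain s where s: "card \<mu> = card \<nu> + s * l"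
    "\<And>k. k < l \<Longrightarrow> residue_count l \<mu> k = residue_count l (transp_diag \<nu>) k + s"
    using residue_count_rim_hook_chain l card_transp_diag by metis
  have "s = n" using s(1) card_mu l by simp
  then show ?thesis using s(2)[OF k] residue_count_transp_diag by simp
qed

section \<open>Sums of \<open>\<theta>\<close> over intervals\<close>

definition theta_sum :: "nat \<Rightarrow> (nat \<Rightarrow> rat) \<Rightarrow> int \<Rightarrow> nat \<Rightarrow> complex" where
  "theta_sum l \<theta> x L = (\<Sum>s<L. th l \<theta> (x + int s))"

lemma theta_sum_add: "theta_sum l \<theta> x (L1 + L2) = theta_sum l \<theta> x L1 + theta_sum l \<theta> (x + int L1) L2"
  unfolding theta_sum_def by (induction L2) (simp_all add: algebra_simps)

lemma theta_sum_Suc: "theta_sum l \<theta> x (Suc L) = th l \<theta> x + theta_sum l \<theta> (x + 1) L"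
  using theta_sum_add[of l \<theta> x 1 L] by (simp add: theta_sum_def)

lemma sum_th_downwards: "(\<Sum>x\<in>{1..t}. th l \<theta> (int r - int x)) = theta_sum l \<theta> (int r - int t) t"
proof (induction t)
  case (Suc t)
  have "(\<Sum>x\<in>{1..Suc t}. th l \<theta> (int r - int x)) = th l \<theta> (int r - int (Suc t)) + theta_sum l \<theta> (int r - int t) t"
    using Suc by simp
  also have "\<dots> = theta_sum l \<theta> (int r - int (Suc t)) (Suc t)" by (simp add: theta_sum_Suc)
  finally show ?case .
qed (simp add: theta_sum_def)

lemma sum_group_by_value:
  fixes g :: "nat \<Rightarrow> rat" and h :: "nat \<Rightarrow> nat"
  assumes "\<And>s. h s < l"
  shows "(\<Sum>s<L. g (h s)) = (\<Sum>k<l. g k * of_nat (card {s. s < L \<and> h s = k}))"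
proof -
  have "(\<Sum>k<l. g k * of_nat (card {s. s < L \<and> h s = k})) = (\<Sum>k<l. \<Sum>s<L. if h s = k then g k else 0)"
  proof (rule sum.cong[OF refl])
    fix k
    have "{s. s < L \<and> h s = k} = {s \<in> {..<L}. h s = k}" by auto
    then show "g k * of_nat (card {s. s < L \<and> h s = k}) = (\<Sum>s<L. if h s = k then g k else 0)"
      using sum.inter_filter[of "{..<L}" "\<lambda>_. g k" "\<lambda>s. h s = k"] by (simp add: mult.commute)
  qed
  also have "\<dots> = (\<Sum>s<L. \<Sum>k<l. if h s = k then g k else 0)" by (rule sum.swap)
  also have "\<dots> = (\<Sum>s<L. g (h s))" using assms by (simp add: sum.delta')
  finally show ?thesis by simp
qed

lemma mod_add_of_nat_eq:
  assumes "l > 0"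
  shows "(x + int s) mod int l = int ((nat (x mod int l) + s) mod l)"
proof -
  have "(x + int s) mod int l = (int (nat (x mod int l)) + int s) mod int l"
    using assms by (simp add: mod_add_left_eq)
  also have "\<dots> = int ((nat (x mod int l) + s) mod l)" by (simp only: zmod_int of_nat_add)
  finally show ?thesis .
qed

lemma theta_sum_eq_cyc_root:
  assumes l: "l > 0"
  shows "theta_sum l \<theta> x L = of_rat (\<Sum>k<l. \<theta> k * of_nat (cyc_root l (nat (x mod int l)) L k))"
proof -
  define i where "i = nat (x mod int l)"
  have "nat ((x + int s) mod int l) = (i + s) mod l" for s
    unfolding i_def mod_add_of_nat_eq[OF l] by simp
  then have "theta_sum l \<theta> x L = of_rat (\<Sum>s<L. \<theta> ((i + s) mod l))"
    unfolding theta_sum_def th_def by (simp add: of_rat_sum)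
  also have "(\<Sum>s<L. \<theta> ((i + s) mod l)) = (\<Sum>k<l. \<theta> k * of_nat (cyc_root l i L k))"
    unfolding cyc_root_def by (rule sum_group_by_value) (use l in simp)
  finally show ?thesis unfolding i_def .
qed

context young_diagram
begin

text \<open>The last \<open>L\<close> positions of a block lie on \<open>L\<close> cells of the hook with consecutive
  contents, so the cyclic root of the corresponding \<open>\<theta>\<close>-sum is bounded by the residue
  counts of \<open>Y\<close>.\<close>
lemma cyc_root_le_residue_count:
  assumes l: "l > 0" and b: "b < K" and L: "L \<le> m b" and k: "k < l"
  shows "cyc_root l (nat (- int (m b - r b) mod int l)) L k \<le> residue_count l Y k"
proof -
  define x where "x = - int (m b - r b)"
  let ?S = "{s. s < L \<and> (nat (x mod int l) + s) mod l = k}"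
  let ?f = "\<lambda>s. hook_cell b (m b - s)"
  have idx: "(b, m b - s) \<in> block_index" if "s < L" for s
    using that b L by (auto intro: block_indexI)
  have "inj_on ?f ?S"
  proof (rule inj_onI)
    fix s s' assume "s \<in> ?S" "s' \<in> ?S" "?f s = ?f s'"
    then have "(b, m b - s) = (b, m b - s')"
      by (intro inj_onD[OF inj_on_hook_cell, of "(b, m b - s)"]) (auto intro: idx)
    then show "s = s'" using \<open>s \<in> ?S\<close> \<open>s' \<in> ?S\<close> L by auto
  qed
  moreover have "?f ` ?S \<subseteq> {c \<in> Y. (- content c) mod int l = int k}"
  proof
    fix c assume "c \<in> ?f ` ?S"
    then obtain s where s: "s < L" "(nat (x mod int l) + s) mod l = k" "c = ?f s" by blast
    have "- content c = x + int s"
      using s L content_hook_cell[of b "m b - s"] rr_le_mm[of b] unfolding x_def by simp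
    then show "c \<in> {c \<in> Y. (- content c) mod int l = int k}"
      using hook_cell_mem[OF idx[OF s(1)]] s mod_add_of_nat_eq[OF l, of x s] by simp
  qed
  moreover have "finite {c \<in> Y. (- content c) mod int l = int k}" using finite_cells by simp
  ultimately have "card ?S \<le> residue_count l Y k"
    unfolding residue_count_def by (rule card_inj_on_le)
  then show ?thesis unfolding cyc_root_def x_def .
qed

lemma theta_sum_nonzero:
  assumes l: "l > 0" and gen: "theta_generic l \<theta> v" and count: "\<And>k. k < l \<Longrightarrow> residue_count l Y k \<le> v k"
    and b: "b < K" and L: "1 \<le> L" "L \<le> m b"
  shows "theta_sum l \<theta> (- int (m b - r b)) L \<noteq> 0"
proof -
  let ?i = "nat (- int (m b - r b) mod int l)"
  have "?i < l" using l by (simp add: nat_less_iff)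
  moreover have "cyc_root l ?i L k \<le> v k" if "k < l" for k
    using cyc_root_le_residue_count[OF l b L(2) that] count[OF that] by simp
  ultimately have "(\<Sum>k<l. \<theta> k * of_nat (cyc_root l ?i L k)) \<noteq> 0"
    using gen L(1) unfolding theta_generic_def by blast
  then show ?thesis unfolding theta_sum_eq_cyc_root[OF l] by simp
qed

end

section \<open>The off-diagonal blocks of \<open>A(\<mu>)\<close>\<close>

text \<open>Entry \<open>(s, t)\<close> (1-based) of \<open>\<Lambda>(mb) M - M \<Lambda>(mc)\<close> for an \<open>mb \<times> mc\<close> matrix \<open>M\<close>.\<close>
definition Lambda_comm :: "nat \<Rightarrow> nat \<Rightarrow> (nat \<Rightarrow> nat \<Rightarrow> complex) \<Rightarrow> nat \<Rightarrow> nat \<Rightarrow> complex" where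
  "Lambda_comm mb mc M s t = (if s < mb then M (s + 1) t else 0) - (if 1 < t then M s (t - 1) else 0)"

definition diag_supported :: "nat \<Rightarrow> nat \<Rightarrow> int \<Rightarrow> (nat \<Rightarrow> nat \<Rightarrow> complex) \<Rightarrow> bool" where
  "diag_supported mb mc D M \<longleftrightarrow>
     (\<forall>s t. M s t \<noteq> 0 \<longrightarrow> 1 \<le> s \<and> s \<le> mb \<and> 1 \<le> t \<and> t \<le> mc \<and> int t - int s = D)"

lemma offblk_def':
  "offblk l \<theta> Y b c = (THE M. diag_supported (mm Y b) (mm Y c) (int (rr Y c) - int (rr Y b) - 1) M \<and>
     (\<forall>s t. 1 \<le> s \<longrightarrow> s \<le> mm Y b \<longrightarrow> 1 \<le> t \<longrightarrow> t \<le> mm Y c \<longrightarrow>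
        Lambda_comm (mm Y b) (mm Y c) M s t = (if s = rr Y b \<and> t = rr Y c then - beta l \<theta> Y b else 0)))"
  unfolding offblk_def diag_supported_def Lambda_comm_def ..

lemma Lambda_comm_injective_neg_diag:
  assumes supp: "diag_supported mb mc D \<Delta>" and D: "D < 0"
    and eqn: "\<And>s t. 1 \<le> s \<Longrightarrow> s \<le> mb \<Longrightarrow> 1 \<le> t \<Longrightarrow> t \<le> mc \<Longrightarrow> Lambda_comm mb mc \<Delta> s t = 0"
  shows "\<Delta> s t = 0"
proof (induction t arbitrary: s)
  case 0
  then show ?case using supp unfolding diag_supported_def by auto
next
  case (Suc t)
  show ?case
  proof (rule ccontr)
    assume nz: "\<Delta> s (Suc t) \<noteq> 0"
    then have "1 \<le> s" "s \<le> mb" "Suc t \<le> mc" "int (Suc t) - int s = D"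
      using supp unfolding diag_supported_def by blast+
    then have "2 \<le> s" "Lambda_comm mb mc \<Delta> (s - 1) (Suc t) = 0" using D eqn[of "s - 1" "Suc t"] by auto
    then have "\<Delta> s (Suc t) = (if 1 < Suc t then \<Delta> (s - 1) t else 0)"
      using \<open>s \<le> mb\<close> unfolding Lambda_comm_def by (simp split: if_splits)
    then show False using nz Suc.IH[of "s - 1"] by (simp split: if_splits)
  qed
qed

lemma Lambda_comm_injective_short_diag:
  assumes supp: "diag_supported mb mc D \<Delta>" and D: "int mb + D < int mc"
    and eqn: "\<And>s t. 1 \<le> s \<Longrightarrow> s \<le> mb \<Longrightarrow> 1 \<le> t \<Longrightarrow> t \<le> mc \<Longrightarrow> Lambda_comm mb mc \<Delta> s t = 0"
  shows "\<Delta> s t = 0"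
proof (induction "mb - s" arbitrary: s t rule: less_induct)
  case less
  show ?case
  proof (rule ccontr)
    assume nz: "\<Delta> s t \<noteq> 0"
    then have st: "1 \<le> s" "s \<le> mb" "1 \<le> t" "t \<le> mc" "int t - int s = D"
      using supp unfolding diag_supported_def by blast+
    then have "t + 1 \<le> mc" using D by linarith
    then have "Lambda_comm mb mc \<Delta> s (t + 1) = 0" using eqn st by simp
    moreover have "s < mb \<Longrightarrow> \<Delta> (s + 1) (t + 1) = 0" using less[of "s + 1"] by simp
    ultimately show False using nz st unfolding Lambda_comm_def by (simp split: if_splits)
  qed
qed

lemma offblk_eqI:
  fixes Y :: "(nat \<times> nat) set" and b c :: nat and M :: "nat \<Rightarrow> nat \<Rightarrow> complex"
  defines "D \<equiv> int (rr Y c) - int (rr Y b) - 1"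
  assumes supp: "diag_supported (mm Y b) (mm Y c) D M"
    and eqn: "\<And>s t. 1 \<le> s \<Longrightarrow> s \<le> mm Y b \<Longrightarrow> 1 \<le> t \<Longrightarrow> t \<le> mm Y c \<Longrightarrow>
      Lambda_comm (mm Y b) (mm Y c) M s t = (if s = rr Y b \<and> t = rr Y c then - beta l \<theta> Y b else 0)"
    and unique: "D < 0 \<or> int (mm Y b) + D < int (mm Y c)"
  shows "offblk l \<theta> Y b c = M"
  unfolding offblk_def' D_def[symmetric]
proof (rule the_equality)
  fix M' assume M': "diag_supported (mm Y b) (mm Y c) D M' \<and>
     (\<forall>s t. 1 \<le> s \<longrightarrow> s \<le> mm Y b \<longrightarrow> 1 \<le> t \<longrightarrow> t \<le> mm Y c \<longrightarrow>
        Lambda_comm (mm Y b) (mm Y c) M' s t = (if s = rr Y b \<and> t = rr Y c then - beta l \<theta> Y b else 0))"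
  let ?\<Delta> = "\<lambda>s t. M' s t - M s t"
  have "diag_supported (mm Y b) (mm Y c) D ?\<Delta>"
    using supp M' unfolding diag_supported_def by (metis diff_zero)
  moreover have "Lambda_comm (mm Y b) (mm Y c) ?\<Delta> s t = 0"
    if "1 \<le> s" "s \<le> mm Y b" "1 \<le> t" "t \<le> mm Y c" for s t
  proof -
    have "Lambda_comm (mm Y b) (mm Y c) ?\<Delta> s t =
        Lambda_comm (mm Y b) (mm Y c) M' s t - Lambda_comm (mm Y b) (mm Y c) M s t"
      unfolding Lambda_comm_def by simp
    then show ?thesis using eqn[OF that] M' that by simp
  qed
  ultimately have "?\<Delta> s t = 0" for s t
    using unique Lambda_comm_injective_neg_diag Lambda_comm_injective_short_diag by blast
  then show "M' = M" by (intro ext) simp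
qed (use supp eqn in blast)

lemma Lambda_comm_lower_solution:
  fixes rb rc mb mc :: nat and \<beta> :: complex
  assumes "1 \<le> rc" "rc < rb" "rb < mb" "int mc - int rc < int mb - int rb" "rc \<le> mc"
    and "1 \<le> s" "s \<le> mb" "1 \<le> t" "t \<le> mc"
  defines "M \<equiv> \<lambda>s t. (if int t - int s = int rc - int rb - 1 \<and> rb < s \<and> s \<le> mb \<and> 1 \<le> t \<and> t \<le> mc then - \<beta> else 0)"
  shows "Lambda_comm mb mc M s t = (if s = rb \<and> t = rc then - \<beta> else 0)"
  using assms(1-9) unfolding Lambda_comm_def M_def by auto

lemma Lambda_comm_upper_solution:
  fixes rb rc mb mc :: nat and \<beta> :: complex
  assumes "1 \<le> rb" "rb < rc" "rb \<le> mb" "int mb - int rb < int mc - int rc" "rc \<le> mc"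
    and "1 \<le> s" "s \<le> mb" "1 \<le> t" "t \<le> mc"
  defines "M \<equiv> \<lambda>s t. (if int t - int s = int rc - int rb - 1 \<and> 1 \<le> s \<and> s \<le> rb \<and> 1 \<le> t \<and> t \<le> mc then \<beta> else 0)"
  shows "Lambda_comm mb mc M s t = (if s = rb \<and> t = rc then - \<beta> else 0)"
  using assms(1-9) unfolding Lambda_comm_def M_def by auto

context young_diagram
begin

lemma offblk_less:
  assumes bc: "b < c" and c: "c < K"
  shows "offblk l \<theta> Y b c = (\<lambda>s t. if int t - int s = int (r c) - int (r b) - 1 \<and> r b < s \<and> s \<le> m b \<and>
      1 \<le> t \<and> t \<le> m c then - beta l \<theta> Y b else 0)" (is "_ = ?M")
proof (rule offblk_eqI)
  have "r c < r b" "m c - r c < m b - r b" using rr_strict_antimono[OF bc c] arm_strict_antimono[OF bc c] .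
  then show "Lambda_comm (m b) (m c) ?M s t = (if s = r b \<and> t = r c then - beta l \<theta> Y b else 0)"
    if "1 \<le> s" "s \<le> m b" "1 \<le> t" "t \<le> m c" for s t
    using rr_pos[of c] rr_le_mm[of b] rr_le_mm[of c] by (intro Lambda_comm_lower_solution that) auto
  show "int (r c) - int (r b) - 1 < 0 \<or> int (m b) + (int (r c) - int (r b) - 1) < int (m c)"
    using \<open>r c < r b\<close> by simp
qed (auto simp: diag_supported_def dest: order.strict_trans1[OF rr_pos])

lemma offblk_greater:
  assumes cb: "c < b" and b: "b < K"
  shows "offblk l \<theta> Y b c = (\<lambda>s t. if int t - int s = int (r c) - int (r b) - 1 \<and> 1 \<le> s \<and> s \<le> r b \<and>
      1 \<le> t \<and> t \<le> m c then beta l \<theta> Y b else 0)" (is "_ = ?M")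
proof (rule offblk_eqI)
  have "r b < r c" "m b - r b < m c - r c" using rr_strict_antimono[OF cb b] arm_strict_antimono[OF cb b] .
  then show "Lambda_comm (m b) (m c) ?M s t = (if s = r b \<and> t = r c then - beta l \<theta> Y b else 0)"
    if "1 \<le> s" "s \<le> m b" "1 \<le> t" "t \<le> m c" for s t
    using rr_pos[of b] rr_le_mm[of b] rr_le_mm[of c] by (intro Lambda_comm_upper_solution that) auto
  then show "int (r c) - int (r b) - 1 < 0 \<or> int (m b) + (int (r c) - int (r b) - 1) < int (m c)"
    using \<open>m b - r b < m c - r c\<close> rr_le_mm[of b] rr_le_mm[of c] by linarith
qed (auto simp: diag_supported_def dest: order.trans[OF _ rr_le_mm])

end

interpretation cs: vector_space cscale
  by unfold_locales (auto simp: cscale_def algebra_simps fun_eq_iff)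

lemma sum_fun_apply: "(\<Sum>x\<in>S. f x) p = (\<Sum>x\<in>S. f x p)"
  by (induction S rule: infinite_finite_induct) auto

definition unit_vec :: "nat \<Rightarrow> nat \<Rightarrow> complex" where
  "unit_vec p = (\<lambda>q. if q = p then 1 else 0)"

lemma unit_vec_eq_iff: "unit_vec p = unit_vec q \<longleftrightarrow> p = q"
proof
  assume "unit_vec p = unit_vec q"
  then have "unit_vec p p = unit_vec q p" by simp
  then show "p = q" unfolding unit_vec_def by (cases "p = q") auto
qed simp

lemma unit_vec_nonzero: "unit_vec p \<noteq> 0"
proof
  assume "unit_vec p = 0"
  then have "unit_vec p p = 0" by simp
  then show False unfolding unit_vec_def by simp
qed

lemma independent_unit_vecs: "\<not> cs.dependent (unit_vec ` S)"
proof
  assume "cs.dependent (unit_vec ` S)"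
  then obtain T u v0 where T: "finite T" "T \<subseteq> unit_vec ` S" "(\<Sum>v\<in>T. cscale (u v) v) = 0"
    and v0: "v0 \<in> T" "u v0 \<noteq> 0"
    unfolding cs.dependent_explicit by blast
  then obtain p0 where p0: "v0 = unit_vec p0" by blast
  have "(\<Sum>v\<in>T. cscale (u v) v) p0 = (\<Sum>v\<in>T. if v = v0 then u v else 0)"
    unfolding sum_fun_apply cscale_def
    using T(2) p0 unit_vec_eq_iff by (intro sum.cong) (auto simp: unit_vec_def)
  also have "\<dots> = u v0" using v0 T(1) by (simp add: sum.delta')
  finally show False using T(3) v0 by simp
qed

lemma mat_app_unit_vec: "q < N \<Longrightarrow> mat_app N M (unit_vec q) = (\<lambda>p. if p < N then M p q else 0)"
  unfolding mat_app_def unit_vec_def by (auto simp: if_distrib cong: if_cong)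

lemma mat_app_beyond: "N \<le> p \<Longrightarrow> mat_app N M v p = 0"
  unfolding mat_app_def by simp

lemma Aloc_subdiag_upper: "1 \<le> t \<Longrightarrow> t < r \<Longrightarrow> r \<le> m \<Longrightarrow> Aloc l \<theta> m r (t + 1) t = theta_sum l \<theta> (int r - int t) t"
  unfolding Aloc_def using sum_th_downwards[of l \<theta> r t] by simp

lemma Aloc_subdiag_lower:
  "1 \<le> t \<Longrightarrow> r \<le> t \<Longrightarrow> t < m \<Longrightarrow> Aloc l \<theta> m r (t + 1) t = - theta_sum l \<theta> (- int (m - r)) (m - t)"
  unfolding Aloc_def theta_sum_def by (simp add: atLeast0LessThan algebra_simps)

lemma Aloc_off_subdiag: "s \<noteq> t + 1 \<Longrightarrow> Aloc l \<theta> m r s t = 0"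
  unfolding Aloc_def by simp

text \<open>\<open>\<beta>\<^sub>b\<close> sums \<open>\<theta>\<close> over the negated contents of the cells of the \<open>b\<close>-th hook.\<close>
lemma beta_eq_theta_sum:
  assumes "1 \<le> rr Y b" "rr Y b \<le> mm Y b"
  shows "beta l \<theta> Y b = theta_sum l \<theta> (- int (mm Y b - rr Y b)) (mm Y b)"
proof -
  let ?r = "rr Y b" and ?m = "mm Y b"
  have "(\<Sum>s\<in>{1..<?r}. th l \<theta> (int ?r - int s)) = theta_sum l \<theta> 1 (?r - 1)"
    using sum_th_downwards[of l \<theta> ?r "?r - 1"] assms atLeastLessThanSuc_atLeastAtMost[of 1 "?r - 1"]
    by (simp add: of_nat_diff)
  moreover have "(\<Sum>s\<in>{0..<?m - ?r}. th l \<theta> (- int ?m + int ?r + int s)) =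
      theta_sum l \<theta> (- int (?m - ?r)) (?m - ?r)"
    unfolding theta_sum_def using assms by (simp add: atLeast0LessThan of_nat_diff)
  moreover have "theta_sum l \<theta> (- int (?m - ?r)) ((?m - ?r) + Suc (?r - 1)) =
      theta_sum l \<theta> (- int (?m - ?r)) (?m - ?r) + (th l \<theta> 0 + theta_sum l \<theta> 1 (?r - 1))"
    unfolding theta_sum_add theta_sum_Suc using assms by simp
  moreover have "(?m - ?r) + Suc (?r - 1) = ?m" using assms by simp
  ultimately show ?thesis unfolding beta_def by (simp add: algebra_simps)
qed

context young_diagram
begin

abbreviation "N \<equiv> card Y"

definition basis_vec :: "nat \<Rightarrow> nat \<Rightarrow> nat \<Rightarrow> complex" where
  "basis_vec b u = unit_vec (pos b u)"

text \<open>\<open>deg (pos b u)\<close> is minus the content of \<open>hook_cell b u\<close>.\<close>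
definition deg :: "nat \<Rightarrow> int" where
  "deg p = int (r (blk Y p)) - int (loc Y p)"

lemma pos_less_card: "(b, u) \<in> block_index \<Longrightarrow> pos b u < N"
  using pos_less_offs card_eq_offs by simp

lemma less_card_cases:
  assumes "p < N"
  obtains b u where "(b, u) \<in> block_index" "p = pos b u"
  using less_offs_cases[of p] assms card_eq_offs by metis

lemma deg_pos: "(b, u) \<in> block_index \<Longrightarrow> deg (pos b u) = int (r b) - int u"
  unfolding deg_def using blk_pos loc_pos by simp

lemma basis_vec_pos:
  "(b, s) \<in> block_index \<Longrightarrow> (c, t) \<in> block_index \<Longrightarrow> basis_vec c t (pos b s) = (if b = c \<and> s = t then 1 else 0)"
  unfolding basis_vec_def unit_vec_def using pos_inj by auto

lemma scaled_basis_vec_pos: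
  "(b, s) \<in> block_index \<Longrightarrow> (c, t) \<in> block_index \<Longrightarrow> cscale x (basis_vec c t) (pos b s) = (if b = c \<and> s = t then x else 0)"
  unfolding cscale_def using basis_vec_pos by simp

lemma scaled_basis_vec_beyond: "N \<le> p \<Longrightarrow> (c, t) \<in> block_index \<Longrightarrow> cscale x (basis_vec c t) p = 0"
  unfolding cscale_def basis_vec_def unit_vec_def using pos_less_card[of c t] by auto

lemma vec_eq_onI:
  assumes "\<And>p. N \<le> p \<Longrightarrow> f p = g p" and "\<And>b s. (b, s) \<in> block_index \<Longrightarrow> f (pos b s) = g (pos b s)"
  shows "f = g"
proof
  fix p show "f p = g p"
    using assms by (cases "p < N") (auto elim: less_card_cases)
qed

lemma A_basis_vec_pos:
  assumes bs: "(b, s) \<in> block_index" and ct: "(c, t) \<in> block_index"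
  shows "mat_app N (Amat l \<theta> Y) (basis_vec c t) (pos b s) =
    (if b = c then Aloc l \<theta> (m b) (r b) s t else offblk l \<theta> Y b c s t)"
proof -
  have "mat_app N (Amat l \<theta> Y) (basis_vec c t) (pos b s) = Amat l \<theta> Y (pos b s) (pos c t)"
    unfolding basis_vec_def mat_app_unit_vec[OF pos_less_card[OF ct]] using pos_less_card[OF bs] by simp
  then show ?thesis
    unfolding Amat_def blk_pos[OF bs] blk_pos[OF ct] loc_pos[OF bs] loc_pos[OF ct] by simp
qed

lemma Jvec_pos:
  assumes bs: "(b, s) \<in> block_index"
  shows "Jvec l \<theta> Y (pos b s) = (if s = r b then beta l \<theta> Y b else 0)"
proof -
  have corner: "offs Y b' + r b' - 1 = pos b' (r b')" for b' by (simp only: pos_def)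
  have iff: "b' < K \<and> pos b s = pos b' (r b') \<longleftrightarrow> b' = b \<and> s = r b" for b'
  proof
    assume "b' < K \<and> pos b s = pos b' (r b')"
    then show "b' = b \<and> s = r b" using pos_inj[OF bs block_indexI[OF _ rr_pos rr_le_mm]] by auto
  qed (use bs in \<open>auto dest: block_indexD\<close>)
  show ?thesis
  proof (cases "s = r b")
    case True
    then have "(THE b'. b' < K \<and> pos b s = pos b' (r b')) = b"
      using iff by (intro the_equality) blast+
    then show ?thesis unfolding Jvec_def corner using iff True by auto
  next
    case False
    then show ?thesis unfolding Jvec_def corner using iff by auto
  qed
qed

lemma Jvec_beyond:
  assumes "N \<le> p"
  shows "Jvec l \<theta> Y p = 0"
proof -
  have "p \<noteq> offs Y b + r b - 1" if "b < K" for b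
    using pos_less_card[OF block_indexI[OF that rr_pos rr_le_mm]] assms unfolding pos_def by simp
  then show ?thesis unfolding Jvec_def by auto
qed

lemma L_pos:
  assumes bs: "(b, s) \<in> block_index"
  shows "mat_app N (Lmat Y) v (pos b s) = (if s < m b then v (pos b (s + 1)) else 0)"
proof -
  have next_idx: "s < m b \<Longrightarrow> (b, s + 1) \<in> block_index" using bs by (auto dest: block_indexD intro: block_indexI)
  have "Lmat Y (pos b s) q * v q = (if q = pos b (s + 1) \<and> s < m b then v q else 0)" if "q < N" for q
  proof -
    obtain c w where cw: "(c, w) \<in> block_index" "q = pos c w" using less_card_cases[OF \<open>q < N\<close>] .
    have "(b = c \<and> w = s + 1) \<longleftrightarrow> (q = pos b (s + 1) \<and> s < m b)"
      using cw next_idx pos_inj[OF cw(1), of b "s + 1"] block_indexD[OF cw(1)] by auto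
    then show ?thesis unfolding Lmat_def cw(2) blk_pos[OF bs] blk_pos[OF cw(1)] loc_pos[OF bs] loc_pos[OF cw(1)]
      by auto
  qed
  then have "mat_app N (Lmat Y) v (pos b s) = (\<Sum>q<N. if q = pos b (s + 1) \<and> s < m b then v q else 0)"
    unfolding mat_app_def using pos_less_card[OF bs] by simp
  also have "\<dots> = (if s < m b then v (pos b (s + 1)) else 0)"
    using pos_less_card[OF next_idx] by (cases "s < m b") (simp_all add: sum.delta')
  finally show ?thesis .
qed

end

section \<open>Homogeneity of the coordinate vectors\<close>

locale mu_grading = young_diagram +
  fixes l :: nat and \<theta> :: "nat \<Rightarrow> rat" and W :: "int \<Rightarrow> (nat \<Rightarrow> complex) set"
  assumes grading: "is_mu_grading l \<theta> Y W"
    and theta_sum_hook_nonzero: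
      "\<And>b L. b < K \<Longrightarrow> 1 \<le> L \<Longrightarrow> L \<le> m b \<Longrightarrow> theta_sum l \<theta> (- int (m b - r b)) L \<noteq> 0"
begin

abbreviation "\<beta> \<equiv> beta l \<theta> Y"
abbreviation "\<A> \<equiv> mat_app N (Amat l \<theta> Y)"
abbreviation "\<Lambda> \<equiv> mat_app N (Lmat Y)"

lemma grading_unfolded:
  "(\<forall>i. cs.subspace (W i) \<and> W i \<subseteq> Vsp N) \<and>
   (\<forall>v\<in>Vsp N. \<exists>!w. (\<forall>i. w i \<in> W i) \<and> finite {i. w i \<noteq> 0} \<and> v = (\<Sum>i\<in>{i. w i \<noteq> 0}. w i)) \<and>
   (\<forall>i. \<forall>w\<in>W i. \<A> w \<in> W (i - 1)) \<and> (\<forall>i. \<forall>w\<in>W i. \<Lambda> w \<in> W (i + 1)) \<and>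
   range (\<lambda>c. cscale c (Jvec l \<theta> Y)) \<subseteq> W 0 \<and> row_app N (Ivec Y) ` W 0 = UNIV"
  using grading unfolding is_mu_grading_def Let_def .

lemma subspace_W: "cs.subspace (W i)"
  using grading_unfolded by simp

lemma W_subset_Vsp: "W i \<subseteq> Vsp N"
  using grading_unfolded by simp

lemma W_decomposition_unique:
  "v \<in> Vsp N \<Longrightarrow> \<exists>!w. (\<forall>i. w i \<in> W i) \<and> finite {i. w i \<noteq> 0} \<and> v = (\<Sum>i\<in>{i. w i \<noteq> 0}. w i)"
  using conjunct1[OF conjunct2[OF grading_unfolded]] by (rule bspec)

lemma A_W: "w \<in> W i \<Longrightarrow> \<A> w \<in> W (i - 1)"
  using grading_unfolded by simp

lemma Lambda_W: "w \<in> W i \<Longrightarrow> \<Lambda> w \<in> W (i + 1)"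
  using grading_unfolded by simp

lemma Jvec_W: "Jvec l \<theta> Y \<in> W 0"
proof -
  have "range (\<lambda>c. cscale c (Jvec l \<theta> Y)) \<subseteq> W 0"
    using grading_unfolded by simp
  then have "cscale 1 (Jvec l \<theta> Y) \<in> W 0" by blast
  then show ?thesis by (simp add: cscale_def)
qed

lemma zero_W: "0 \<in> W i" by (rule cs.subspace_0[OF subspace_W])
lemma add_W: "x \<in> W i \<Longrightarrow> y \<in> W i \<Longrightarrow> x + y \<in> W i" by (rule cs.subspace_add[OF subspace_W])
lemma diff_W: "x \<in> W i \<Longrightarrow> y \<in> W i \<Longrightarrow> x - y \<in> W i" by (rule cs.subspace_diff[OF subspace_W])
lemma scale_W: "x \<in> W i \<Longrightarrow> cscale a x \<in> W i" by (rule cs.subspace_scale[OF subspace_W])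

lemma scale_W_cancel: "a \<noteq> 0 \<Longrightarrow> cscale a x \<in> W i \<Longrightarrow> x \<in> W i"
  using scale_W[of "cscale a x" i "1 / a"] by (simp add: cscale_def)

lemma beta_split:
  assumes "c < K" "u \<le> m c"
  shows "\<beta> c = theta_sum l \<theta> (- int (m c - r c)) (m c - u) + theta_sum l \<theta> (int (r c) - int u) u"
proof -
  have "\<beta> c = theta_sum l \<theta> (- int (m c - r c)) ((m c - u) + u)"
    using beta_eq_theta_sum[OF rr_pos rr_le_mm] assms by simp
  also have "\<dots> = theta_sum l \<theta> (- int (m c - r c)) (m c - u) + theta_sum l \<theta> (int (r c) - int u) u"
    unfolding theta_sum_add using assms rr_le_mm[of c] by (simp add: of_nat_diff)
  finally show ?thesis .
qed

lemma beta_nonzero: "b < K \<Longrightarrow> \<beta> b \<noteq> 0"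
  using beta_eq_theta_sum[OF rr_pos rr_le_mm] theta_sum_hook_nonzero[OF _ mm_pos order.refl] by simp

lemma leg_coeff_nonzero:
  assumes "c < K" "1 \<le> u" "u < r c"
  shows "Aloc l \<theta> (m c) (r c) (u + 1) u - \<beta> c \<noteq> 0"
  using Aloc_subdiag_upper[OF assms(2,3) rr_le_mm] beta_split[OF assms(1), of u] rr_le_mm[of c]
    theta_sum_hook_nonzero[OF assms(1), of "m c - u"] assms by simp

lemma arm_coeff_nonzero:
  assumes "c < K" "1 \<le> t" "r c \<le> t" "t < m c"
  shows "Aloc l \<theta> (m c) (r c) (t + 1) t \<noteq> 0"
  using Aloc_subdiag_lower[OF assms(2-4)] theta_sum_hook_nonzero[OF assms(1), of "m c - t"] assms by simp

text \<open>For \<open>d \<ge> 0\<close>, \<open>beta_from 0 d = \<Lambda>\<^sup>d J\<close>; cutting off the blocks one at a time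
  isolates the basis vectors of the legs.\<close>
definition beta_from :: "nat \<Rightarrow> int \<Rightarrow> nat \<Rightarrow> complex" where
  "beta_from c d = (\<lambda>p. if p < N \<and> c \<le> blk Y p \<and> deg p = d then \<beta> (blk Y p) else 0)"

text \<open>Up to sign, the contribution of the blocks \<open>b < c\<close> to \<open>A (basis_vec c (r c + d - 1))\<close>.\<close>
definition beta_below :: "nat \<Rightarrow> nat \<Rightarrow> nat \<Rightarrow> complex" where
  "beta_below c d = (\<lambda>p. if p < N \<and> blk Y p < c \<and> deg p = - int d then \<beta> (blk Y p) else 0)"

lemma beta_from_pos:
  "(b, s) \<in> block_index \<Longrightarrow> beta_from c d (pos b s) = (if c \<le> b \<and> int (r b) - int s = d then \<beta> b else 0)"
  unfolding beta_from_def using pos_less_card deg_pos blk_pos by simp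

lemma beta_below_pos:
  "(b, s) \<in> block_index \<Longrightarrow> beta_below c d (pos b s) = (if b < c \<and> int (r b) - int s = - int d then \<beta> b else 0)"
  unfolding beta_below_def using pos_less_card deg_pos blk_pos by simp

lemma beta_from_beyond: "N \<le> p \<Longrightarrow> beta_from c d p = 0"
  unfolding beta_from_def by simp

lemma beta_below_beyond: "N \<le> p \<Longrightarrow> beta_below c d p = 0"
  unfolding beta_below_def by simp

lemma Jvec_eq_beta_from: "Jvec l \<theta> Y = beta_from 0 0"
  by (rule vec_eq_onI) (auto simp: Jvec_beyond beta_from_beyond Jvec_pos beta_from_pos)

lemma Lambda_beta_from: "0 \<le> d \<Longrightarrow> \<Lambda> (beta_from 0 d) = beta_from 0 (d + 1)"
proof (rule vec_eq_onI)
  fix b s assume bs: "(b, s) \<in> block_index" and "0 \<le> d"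
  then show "\<Lambda> (beta_from 0 d) (pos b s) = beta_from 0 (d + 1) (pos b s)"
    using rr_le_mm[of b] block_indexD[OF bs] block_indexI[of b "s + 1"]
    by (auto simp: L_pos beta_from_pos)
qed (simp add: mat_app_beyond beta_from_beyond)

lemma beta_from_top:
  assumes c: "c < K"
  shows "beta_from c (int (r c) - 1) = cscale (\<beta> c) (basis_vec c 1)"
proof (rule vec_eq_onI)
  have c1: "(c, 1) \<in> block_index" using c mm_pos by (rule block_indexI[OF _ order.refl])
  fix b s assume bs: "(b, s) \<in> block_index"
  have "c \<le> b \<and> int (r b) - int s = int (r c) - 1 \<longleftrightarrow> b = c \<and> s = 1"
    using rr_strict_antimono[of c b] block_indexD[OF bs] by (cases "b = c") auto
  then show "beta_from c (int (r c) - 1) (pos b s) = cscale (\<beta> c) (basis_vec c 1) (pos b s)"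
    unfolding beta_from_pos[OF bs] scaled_basis_vec_pos[OF bs c1] by auto
qed (use c mm_pos in \<open>simp add: beta_from_beyond scaled_basis_vec_beyond block_indexI\<close>)

lemma beta_from_Suc:
  assumes c: "c < K"
  shows "beta_from (Suc c) (int d) =
    beta_from c (int d) - (if d < r c then cscale (\<beta> c) (basis_vec c (r c - d)) else 0)"
proof (rule vec_eq_onI)
  fix b s assume bs: "(b, s) \<in> block_index"
  have "(c \<le> b \<and> \<not> Suc c \<le> b) \<longleftrightarrow> b = c" by auto
  then show "beta_from (Suc c) (int d) (pos b s) =
      (beta_from c (int d) - (if d < r c then cscale (\<beta> c) (basis_vec c (r c - d)) else 0)) (pos b s)"
    using c block_indexD[OF bs] rr_le_mm[of c]
    by (auto simp: beta_from_pos[OF bs] scaled_basis_vec_pos[OF bs] block_indexI)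
next
  fix p assume "N \<le> p"
  moreover have "d < r c \<Longrightarrow> (c, r c - d) \<in> block_index" using c rr_le_mm[of c] by (auto intro: block_indexI)
  ultimately show "beta_from (Suc c) (int d) p =
      (beta_from c (int d) - (if d < r c then cscale (\<beta> c) (basis_vec c (r c - d)) else 0)) p"
    by (simp add: beta_from_beyond scaled_basis_vec_beyond)
qed

lemma A_basis_vec_leg:
  assumes c: "c < K" and u: "1 \<le> u" "u < r c"
  shows "\<A> (basis_vec c u) =
    cscale (Aloc l \<theta> (m c) (r c) (u + 1) u - \<beta> c) (basis_vec c (u + 1)) + beta_from c (int (r c) - int u - 1)"
    (is "_ = ?rhs")
proof (rule vec_eq_onI)
  have cu: "(c, u) \<in> block_index" and cu1: "(c, u + 1) \<in> block_index"
    using c u rr_le_mm[of c] by (auto intro: block_indexI)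
  fix b s assume bs: "(b, s) \<in> block_index"
  show "\<A> (basis_vec c u) (pos b s) = ?rhs (pos b s)"
  proof (cases b c rule: linorder_cases)
    case equal
    have "int (r c) - int s = int (r c) - int u - 1 \<longleftrightarrow> s = u + 1" by auto
    then show ?thesis
      unfolding A_basis_vec_pos[OF bs cu] plus_fun_apply beta_from_pos[OF bs] scaled_basis_vec_pos[OF bs cu1]
      using equal Aloc_off_subdiag[of s u] by auto
  qed (use c u block_indexD[OF bs] rr_le_mm[of c] in \<open>auto simp: A_basis_vec_pos[OF bs cu]
      beta_from_pos[OF bs] scaled_basis_vec_pos[OF bs cu1[simplified]] offblk_less offblk_greater\<close>)
next
  have "(c, Suc u) \<in> block_index" using c u rr_le_mm[of c] by (auto intro: block_indexI)
  then show "\<A> (basis_vec c u) p = ?rhs p" if "N \<le> p" for p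
    using that by (simp add: mat_app_beyond beta_from_beyond scaled_basis_vec_beyond)
qed

lemma beta_below_0: "beta_below 0 d = 0"
  unfolding beta_below_def by (rule ext) simp

lemma beta_below_Suc:
  assumes c: "c < K"
  shows "beta_below (Suc c) d =
    beta_below c d + (if r c + d \<le> m c then cscale (\<beta> c) (basis_vec c (r c + d)) else 0)"
proof (rule vec_eq_onI)
  fix b s assume bs: "(b, s) \<in> block_index"
  have "(b < Suc c \<and> \<not> b < c) \<longleftrightarrow> b = c" by auto
  then show "beta_below (Suc c) d (pos b s) =
      (beta_below c d + (if r c + d \<le> m c then cscale (\<beta> c) (basis_vec c (r c + d)) else 0)) (pos b s)"
    using c block_indexD[OF bs] rr_pos[of c]
    by (auto simp: beta_below_pos[OF bs] scaled_basis_vec_pos[OF bs] block_indexI)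
next
  fix p assume "N \<le> p"
  moreover have "r c + d \<le> m c \<Longrightarrow> (c, r c + d) \<in> block_index" using c rr_pos[of c] by (auto intro: block_indexI)
  ultimately show "beta_below (Suc c) d p =
      (beta_below c d + (if r c + d \<le> m c then cscale (\<beta> c) (basis_vec c (r c + d)) else 0)) p"
    by (simp add: beta_below_beyond scaled_basis_vec_beyond)
qed

lemma A_basis_vec_arm:
  assumes c: "c < K" and d: "1 \<le> d" "r c + d \<le> m c"
  shows "\<A> (basis_vec c (r c + d - 1)) =
    cscale (Aloc l \<theta> (m c) (r c) (r c + d) (r c + d - 1)) (basis_vec c (r c + d)) - beta_below c d"
    (is "_ = ?rhs")
proof (rule vec_eq_onI)
  have ct: "(c, r c + d - 1) \<in> block_index" and ct1: "(c, r c + d) \<in> block_index"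
    using c d rr_pos[of c] by (auto intro: block_indexI)
  fix b s assume bs: "(b, s) \<in> block_index"
  show "\<A> (basis_vec c (r c + d - 1)) (pos b s) = ?rhs (pos b s)"
    unfolding A_basis_vec_pos[OF bs ct] minus_apply beta_below_pos[OF bs] scaled_basis_vec_pos[OF bs ct1]
    using c d block_indexD[OF bs] rr_pos[of c] Aloc_off_subdiag[of s "r c + d - 1"]
    by (cases b c rule: linorder_cases) (auto simp: offblk_less offblk_greater)
next
  have "(c, r c + d) \<in> block_index" using c d rr_pos[of c] by (auto intro: block_indexI)
  then show "\<A> (basis_vec c (r c + d - 1)) p = ?rhs p" if "N \<le> p" for p
    using that by (simp add: mat_app_beyond beta_below_beyond scaled_basis_vec_beyond)
qed

lemma beta_from_0_W: "beta_from 0 (int d) \<in> W (int d)"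
proof (induction d)
  case 0
  show ?case using Jvec_W Jvec_eq_beta_from by simp
next
  case (Suc d)
  then have "\<Lambda> (beta_from 0 (int d)) \<in> W (int d + 1)" by (rule Lambda_W)
  then show ?case using Lambda_beta_from[of "int d"] by (simp add: add.commute)
qed

lemma basis_vec_leg_W_of_beta_from:
  assumes c: "c < K" and from_W: "\<And>d. beta_from c (int d) \<in> W (int d)"
  shows "1 \<le> u \<Longrightarrow> u \<le> r c \<Longrightarrow> basis_vec c u \<in> W (int (r c) - int u)"
proof (induction u rule: nat_induct_at_least)
  case base
  have "int (r c - 1) = int (r c) - 1" using rr_pos[of c] by simp
  then have "cscale (\<beta> c) (basis_vec c 1) \<in> W (int (r c) - 1)"
    using beta_from_top[OF c] from_W[of "r c - 1"] by simp
  then show ?case using scale_W_cancel[OF beta_nonzero[OF c]] by simp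
next
  case (Suc u)
  then have u: "1 \<le> u" "u < r c" by simp_all
  let ?a = "Aloc l \<theta> (m c) (r c) (u + 1) u - \<beta> c"
  have A_mem: "\<A> (basis_vec c u) \<in> W (int (r c) - int u - 1)"
    using A_W Suc.IH u by simp
  have "int (r c - u - 1) = int (r c) - int u - 1" using u by simp
  then have "beta_from c (int (r c) - int u - 1) \<in> W (int (r c) - int u - 1)"
    using from_W[of "r c - u - 1"] by simp
  with A_mem have "\<A> (basis_vec c u) - beta_from c (int (r c) - int u - 1) \<in> W (int (r c) - int u - 1)"
    by (rule diff_W)
  then have "cscale ?a (basis_vec c (u + 1)) \<in> W (int (r c) - int u - 1)"
    unfolding A_basis_vec_leg[OF c u] by simp
  then have "basis_vec c (u + 1) \<in> W (int (r c) - int u - 1)"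
    by (rule scale_W_cancel[OF leg_coeff_nonzero[OF c u]])
  then show ?case by (simp add: algebra_simps)
qed

lemma beta_from_W: "c \<le> K \<Longrightarrow> beta_from c (int d) \<in> W (int d)"
proof (induction c arbitrary: d)
  case 0
  show ?case by (rule beta_from_0_W)
next
  case (Suc c)
  then have c: "c < K" and from_W: "\<And>d. beta_from c (int d) \<in> W (int d)" by simp_all
  show ?case
  proof (cases "d < r c")
    case True
    then have "basis_vec c (r c - d) \<in> W (int d)"
      using basis_vec_leg_W_of_beta_from[OF c from_W, of "r c - d"] by (simp add: of_nat_diff)
    then have "beta_from c (int d) - cscale (\<beta> c) (basis_vec c (r c - d)) \<in> W (int d)"
      by (intro diff_W from_W scale_W)
    then show ?thesis using True by (simp only: beta_from_Suc[OF c] if_True)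
  next
    case False
    then show ?thesis unfolding beta_from_Suc[OF c] using from_W by simp
  qed
qed

lemma basis_vec_leg_W: "c < K \<Longrightarrow> 1 \<le> u \<Longrightarrow> u \<le> r c \<Longrightarrow> basis_vec c u \<in> W (int (r c) - int u)"
  using basis_vec_leg_W_of_beta_from beta_from_W by simp

lemma beta_below_W:
  assumes d: "1 \<le> d"
    and prev_W: "\<And>c. c < K \<Longrightarrow> r c + d \<le> m c \<Longrightarrow> basis_vec c (r c + d - 1) \<in> W (1 - int d)"
  shows "c \<le> K \<Longrightarrow> beta_below c d \<in> W (- int d) \<and>
    (\<forall>c'<c. r c' + d \<le> m c' \<longrightarrow> basis_vec c' (r c' + d) \<in> W (- int d))"
proof (induction c)
  case 0
  have "beta_below 0 d \<in> W (- int d)" unfolding beta_below_0 by (rule zero_W)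
  then show ?case by simp
next
  case (Suc c)
  then have c: "c < K" and IH: "beta_below c d \<in> W (- int d)"
    "\<forall>c'<c. r c' + d \<le> m c' \<longrightarrow> basis_vec c' (r c' + d) \<in> W (- int d)"
    by simp_all
  show ?case
  proof (cases "r c + d \<le> m c")
    case True
    let ?a = "Aloc l \<theta> (m c) (r c) (r c + d) (r c + d - 1)"
    have "\<A> (basis_vec c (r c + d - 1)) \<in> W (- int d)"
      using A_W[OF prev_W[OF c True]] by simp
    then have "\<A> (basis_vec c (r c + d - 1)) + beta_below c d \<in> W (- int d)"
      using IH(1) by (rule add_W)
    then have "cscale ?a (basis_vec c (r c + d)) \<in> W (- int d)"
      unfolding A_basis_vec_arm[OF c d True] by simp
    moreover have "?a \<noteq> 0" using arm_coeff_nonzero[OF c, of "r c + d - 1"] d True rr_pos[of c] by simp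
    ultimately have arm_W: "basis_vec c (r c + d) \<in> W (- int d)" by (rule scale_W_cancel[rotated])
    have "beta_below (Suc c) d \<in> W (- int d)"
      unfolding beta_below_Suc[OF c] using True add_W[OF IH(1) scale_W[OF arm_W]] by simp
    then show ?thesis using IH(2) arm_W less_Suc_eq by auto
  next
    case False
    then show ?thesis unfolding beta_below_Suc[OF c] using IH less_Suc_eq by auto
  qed
qed

lemma basis_vec_arm_W: "1 \<le> d \<Longrightarrow> c < K \<Longrightarrow> r c + d \<le> m c \<Longrightarrow> basis_vec c (r c + d) \<in> W (- int d)"
proof (induction d arbitrary: c rule: nat_induct_at_least)
  case base
  have "basis_vec c' (r c' + 1 - 1) \<in> W (1 - int 1)" if "c' < K" for c'
    using basis_vec_leg_W[OF that _ order.refl] rr_pos[of c'] by simp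
  then show ?case using beta_below_W[of 1 K] base by simp
next
  case (Suc d)
  have "basis_vec c' (r c' + Suc d - 1) \<in> W (1 - int (Suc d))" if "c' < K" "r c' + Suc d \<le> m c'" for c'
    using Suc.IH[of c'] that by simp
  then show ?case using beta_below_W[of "Suc d" K] Suc.prems by simp
qed

lemma unit_vec_W: "p < N \<Longrightarrow> unit_vec p \<in> W (deg p)"
proof (elim less_card_cases)
  fix b u assume bu: "(b, u) \<in> block_index" and p: "p = pos b u"
  then have "basis_vec b u \<in> W (int (r b) - int u)"
    using basis_vec_leg_W basis_vec_arm_W[of "u - r b" b] block_indexD[OF bu] by (cases "u \<le> r b") auto
  then show "unit_vec p \<in> W (deg p)" unfolding p deg_pos[OF bu] basis_vec_def .
qed

end

section \<open>Dimensions of the graded pieces\<close>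

context mu_grading
begin

definition deg_set :: "int \<Rightarrow> nat set" where
  "deg_set i = {p. p < N \<and> deg p = i}"

definition deg_component :: "(nat \<Rightarrow> complex) \<Rightarrow> int \<Rightarrow> nat \<Rightarrow> complex" where
  "deg_component w j = (\<lambda>p. if p < N \<and> deg p = j then w p else 0)"

lemma deg_component_eq_sum: "deg_component w j = (\<Sum>p\<in>deg_set j. cscale (w p) (unit_vec p))"
proof
  fix q
  have "(\<Sum>p\<in>deg_set j. cscale (w p) (unit_vec p)) q = (\<Sum>p\<in>deg_set j. if p = q then w p else 0)"
    unfolding sum_fun_apply cscale_def unit_vec_def by (rule sum.cong) auto
  also have "\<dots> = deg_component w j q"
    unfolding deg_component_def deg_set_def by (simp add: sum.delta)
  finally show "deg_component w j q = (\<Sum>p\<in>deg_set j. cscale (w p) (unit_vec p)) q" by simp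
qed

lemma deg_component_W: "deg_component w j \<in> W j"
  unfolding deg_component_eq_sum
  by (rule cs.subspace_sum[OF subspace_W]) (auto simp: deg_set_def intro: scale_W unit_vec_W)

lemma deg_component_span: "deg_component w j \<in> cs.span (unit_vec ` deg_set j)"
  unfolding deg_component_eq_sum by (rule cs.span_sum) (auto intro: cs.span_scale cs.span_base)

lemma finite_deg_components: "finite {j. deg_component w j \<noteq> 0}"
proof (rule finite_subset)
  show "{j. deg_component w j \<noteq> 0} \<subseteq> deg ` {..<N}"
    unfolding deg_component_def by (auto simp: fun_eq_iff split: if_splits)
qed simp

lemma sum_deg_components: "w \<in> Vsp N \<Longrightarrow> w = (\<Sum>j\<in>{j. deg_component w j \<noteq> 0}. deg_component w j)"
proof
  fix p assume w: "w \<in> Vsp N"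
  have "(\<Sum>j\<in>{j. deg_component w j \<noteq> 0}. deg_component w j) p =
      (\<Sum>j\<in>{j. deg_component w j \<noteq> 0}. if deg p = j then (if p < N then w p else 0) else 0)"
    unfolding sum_fun_apply deg_component_def by (rule sum.cong) auto
  also have "\<dots> = w p"
  proof (cases "p < N \<and> w p \<noteq> 0")
    case True
    then have "deg_component w (deg p) \<noteq> 0" unfolding deg_component_def by (auto simp: fun_eq_iff)
    then show ?thesis using True finite_deg_components by (simp add: sum.delta)
  next
    case False
    then show ?thesis using w finite_deg_components unfolding Vsp_def by (auto simp: sum.delta)
  qed
  finally show "w p = (\<Sum>j\<in>{j. deg_component w j \<noteq> 0}. deg_component w j) p" by simp
qed

lemma W_component_eq:
  assumes w: "w \<in> W i" and f: "\<forall>j. f j \<in> W j" "finite {j. f j \<noteq> 0}" "w = (\<Sum>j\<in>{j. f j \<noteq> 0}. f j)"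
  shows "f i = w"
proof -
  define g where "g = (\<lambda>j. if j = i then w else 0)"
  have "\<forall>j. g j \<in> W j" unfolding g_def using w zero_W by simp
  moreover have "{j. g j \<noteq> 0} = (if w = 0 then {} else {i})" unfolding g_def by auto
  then have "finite {j. g j \<noteq> 0}" "w = (\<Sum>j\<in>{j. g j \<noteq> 0}. g j)" by (simp_all add: g_def)
  ultimately have "f = g"
    using W_decomposition_unique[OF subsetD[OF W_subset_Vsp w]] f by blast
  then show ?thesis unfolding g_def by simp
qed

lemma W_eq_span: "W i = cs.span (unit_vec ` deg_set i)"
proof
  show "W i \<subseteq> cs.span (unit_vec ` deg_set i)"
  proof
    fix w assume w: "w \<in> W i"
    then have "deg_component w i = w"
      using W_component_eq deg_component_W finite_deg_components sum_deg_components W_subset_Vsp by blast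
    then show "w \<in> cs.span (unit_vec ` deg_set i)" using deg_component_span by metis
  qed
  show "cs.span (unit_vec ` deg_set i) \<subseteq> W i"
    using unit_vec_W by (intro cs.span_minimal[OF _ subspace_W]) (auto simp: deg_set_def)
qed

lemma cdim_W: "cdim (W i) = card (deg_set i)"
proof -
  have "cdim (W i) = card (unit_vec ` deg_set i)"
    unfolding cdim_def W_eq_span using cs.dim_span_eq_card_independent[OF independent_unit_vecs] by simp
  also have "\<dots> = card (deg_set i)"
    by (rule card_image) (auto simp: inj_on_def unit_vec_eq_iff)
  finally show ?thesis .
qed

lemma nontrivial_degrees: "{i. W i \<noteq> {0}} = deg ` {..<N}"
proof -
  have "W i \<noteq> {0} \<longleftrightarrow> deg_set i \<noteq> {}" for i
  proof
    show "W i \<noteq> {0} \<Longrightarrow> deg_set i \<noteq> {}" unfolding W_eq_span by (auto simp: cs.span_empty)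
    assume "deg_set i \<noteq> {}"
    then obtain p where "unit_vec p \<in> W i" unfolding W_eq_span by (auto intro: cs.span_base)
    then show "W i \<noteq> {0}" using unit_vec_nonzero by auto
  qed
  then show ?thesis unfolding deg_set_def by auto
qed

lemma poincare_eq_sum_deg: "poincare W = (\<Sum>p<N. fls_X_intpow (deg p))"
proof -
  have "(\<Sum>p<N. (fls_X_intpow (deg p) :: int fls)) =
        (\<Sum>i\<in>deg ` {..<N}. \<Sum>p\<in>{p \<in> {..<N}. deg p = i}. fls_X_intpow (deg p))"
    by (rule sum.image_gen) simp
  also have "\<dots> = (\<Sum>i\<in>deg ` {..<N}. of_nat (card (deg_set i)) * fls_X_intpow i)"
  proof (rule sum.cong[OF refl])
    fix i
    have "{p \<in> {..<N}. deg p = i} = deg_set i" unfolding deg_set_def by auto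
    then show "(\<Sum>p\<in>{p \<in> {..<N}. deg p = i}. (fls_X_intpow (deg p) :: int fls)) =
        of_nat (card (deg_set i)) * fls_X_intpow i"
      by (simp add: deg_set_def)
  qed
  finally show ?thesis unfolding poincare_def nontrivial_degrees cdim_W by simp
qed

end

lemma (in young_diagram) sum_deg_eq_Res: "(\<Sum>p<N. fls_X_intpow (deg p)) = Res (transp_diag Y)"
proof -
  let ?F = "\<lambda>i. fls_X_intpow i :: int fls"
  have "(\<Sum>p<N. ?F (deg p)) = (\<Sum>(b, u)\<in>block_index. ?F (deg (pos b u)))"
    using sum.reindex_bij_betw[OF bij_betw_pos, of "\<lambda>p. ?F (deg p)"] card_eq_offs
    by (simp add: case_prod_beta')
  also have "\<dots> = (\<Sum>(b, u)\<in>block_index. ?F (- content (hook_cell b u)))"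
    by (rule sum.cong) (auto simp: deg_pos content_hook_cell)
  also have "\<dots> = (\<Sum>c\<in>Y. ?F (- content c))"
    using sum.reindex_bij_betw[OF bij_betw_hook_cell, of "\<lambda>c. ?F (- content c)"]
    by (simp add: case_prod_beta')
  also have "\<dots> = Res (transp_diag Y)"
    unfolding Res_def sum_transp_diag content_swap by simp
  finally show ?thesis .
qed

lemma poincare_eq_Res:
  assumes l: "l > 0" and gen: "theta_generic l \<theta> (\<lambda>i. n + dvec l \<nu> i)"
    and mu: "\<mu> \<in> partitions_with_core l (transp_diag \<nu>) (n * l + card \<nu>)"
    and W: "is_mu_grading l \<theta> \<mu> W"
  shows "poincare W = Res (transp_diag \<mu>)"
proof -
  interpret young_diagram \<mu> using mu unfolding partitions_with_core_def by unfold_locales simp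
  interpret mu_grading \<mu> l \<theta> W
    using W theta_sum_nonzero[OF l gen] residue_count_partitions_with_core[OF l mu] by unfold_locales auto
  show ?thesis using poincare_eq_sum_deg sum_deg_eq_Res by simp
qed

lemma fls_nth_Res: "finite A \<Longrightarrow> fls_nth (Res A) d = int (card {c \<in> A. content c = d})"
proof -
  assume "finite A"
  have "fls_nth (Res A) d = (\<Sum>c\<in>A. if content c = d then 1 else 0)"
    unfolding Res_def fls_nth_sum by (rule sum.cong) auto
  also have "\<dots> = int (card {c \<in> A. content c = d})"
    using \<open>finite A\<close> by (simp add: sum.If_cases Int_def conj_commute eq_commute)
  finally show ?thesis .
qed

lemma (in young_diagram) mem_iff_diagonal_card:
  "(i, j) \<in> Y \<longleftrightarrow> min i j < card {c \<in> Y. content c = int j - int i}"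
proof -
  let ?S = "{c \<in> Y. content c = int j - int i}"
  let ?g = "\<lambda>t. (i - t, j - t)"
  have inj: "inj_on ?g {..min i j}" by (auto simp: inj_on_def)
  show ?thesis
  proof
    assume ij: "(i, j) \<in> Y"
    have "?g ` {..min i j} \<subseteq> ?S"
      using down_closed[OF ij] by (auto simp: content_def)
    then have "card (?g ` {..min i j}) \<le> card ?S" using finite_cells by (intro card_mono) auto
    then show "min i j < card ?S" using card_image[OF inj] by simp
  next
    assume less: "min i j < card ?S"
    show "(i, j) \<in> Y"
    proof (rule ccontr)
      assume nij: "(i, j) \<notin> Y"
      have "?S \<subseteq> ?g ` {1..min i j}"
      proof (clarify)
        fix i' j' assume c: "(i', j') \<in> Y" "content (i', j') = int j - int i"
        then have "i' < i" using nij down_closed[OF c(1), of i j] by (force simp: content_def)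
        then show "(i', j') \<in> ?g ` {1..min i j}"
          using c(2) by (auto simp: content_def image_iff intro!: bexI[of _ "i - i'"])
      qed
      then have "card ?S \<le> card {1..min i j}"
        using card_mono[OF _ \<open>?S \<subseteq> _\<close>] card_image_le[of "{1..min i j}" ?g] by fastforce
      then show False using less by (simp add: min_def split: if_splits)
    qed
  qed
qed

lemma Res_inj:
  assumes "young A" "young B" "Res A = Res B"
  shows "A = B"
proof -
  interpret A: young_diagram A by (rule young_diagram.intro) fact
  interpret B: young_diagram B by (rule young_diagram.intro) fact
  have "card {c \<in> A. content c = d} = card {c \<in> B. content c = d}" for d
    using fls_nth_Res[OF A.finite_cells, of d] fls_nth_Res[OF B.finite_cells, of d] assms(3) by simp
  then show ?thesis using A.mem_iff_diagonal_card B.mem_iff_diagonal_card by (auto simp: set_eq_iff)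
qed

theorem proposition9p3:
  fixes l n :: nat and \<nu> :: "(nat \<times> nat) set" and \<theta> :: "nat \<Rightarrow> rat"
  assumes "l > 1"
    and "is_core l \<nu>"
    and "theta_generic l \<theta> (\<lambda>i. n + dvec l \<nu> i)"
  shows "(\<forall>\<mu>\<in>partitions_with_core l (transp_diag \<nu>) (n * l + card \<nu>).
            \<forall>W. is_mu_grading l \<theta> \<mu> W \<longrightarrow> poincare W = Res (transp_diag \<mu>))
       \<and> (\<forall>\<mu>1\<in>partitions_with_core l (transp_diag \<nu>) (n * l + card \<nu>).
          \<forall>\<mu>2\<in>partitions_with_core l (transp_diag \<nu>) (n * l + card \<nu>).
          \<forall>W1 W2. is_mu_grading l \<theta> \<mu>1 W1 \<longrightarrow> is_mu_grading l \<theta> \<mu>2 W2 \<longrightarrow>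
             poincare W1 = poincare W2 \<longrightarrow> \<mu>1 = \<mu>2)"
proof (intro conjI ballI allI impI)
  have l: "l > 0" using assms(1) by simp
  note poincare = poincare_eq_Res[OF l assms(3)]
  show "poincare W = Res (transp_diag \<mu>)"
    if "\<mu> \<in> partitions_with_core l (transp_diag \<nu>) (n * l + card \<nu>)" "is_mu_grading l \<theta> \<mu> W" for \<mu> W
    using poincare[OF that] .
  fix \<mu>1 \<mu>2 W1 W2
  assume \<mu>1: "\<mu>1 \<in> partitions_with_core l (transp_diag \<nu>) (n * l + card \<nu>)"
    and \<mu>2: "\<mu>2 \<in> partitions_with_core l (transp_diag \<nu>) (n * l + card \<nu>)"
    and "is_mu_grading l \<theta> \<mu>1 W1" "is_mu_grading l \<theta> \<mu>2 W2" "poincare W1 = poincare W2"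
  then have "Res (transp_diag \<mu>1) = Res (transp_diag \<mu>2)" using poincare by metis
  moreover have "young (transp_diag \<mu>1)" "young (transp_diag \<mu>2)"
    using \<mu>1 \<mu>2 young_transp_diag unfolding partitions_with_core_def by auto
  ultimately show "\<mu>1 = \<mu>2" using Res_inj transp_diag_transp_diag by metis
qed

end
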